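(* There exists an absolute constant $\gamma\in(0,1)$ and an online algorithm with the following guarantee. Given an $n$-node simple graph $G$ of maximum degree $\Delta=\omega(\log n)$ whose edges are presented in uniformly random order, the algorithm computes, with high probability, a proper edge coloring of $G$ using at most $\Delta+O\left(\Delta^{\gamma}\cdot \log^{1-\gamma} n\right)=(1+o(1))\Delta$ colors.
   Context: Random-order online edge coloring: an adversary fixes an $n$-node simple graph $G$ of maximum degree $\Delta$. The algorithm knows $n$ and $\Delta$ but not $G$ (in particular it does not know the number of edges or the node degrees). The edges of $G$ are revealed one at a time in a uniformly random order. Immediately upon the arrival of an edge, the algorithm must irrevocably assign it a color, so that no two edges sharing an endpoint receive the same color (a proper edge coloring). The goal is to minimize the number of colors used. "With high probability" means with probability at least $1-1/n^{c}$ for some constant $c>0$. *)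

theory Defs
  imports
    "HOL-Probability.Probability"
    "HOL-Combinatorics.Multiset_Permutations"
    "HOL-Library.Landau_Symbols"
begin

type_synonym edge = "nat set"

definition simple_graph :: "nat set \<Rightarrow> edge set \<Rightarrow> bool" where
  "simple_graph V E \<longleftrightarrow> finite V \<and> (\<forall>e\<in>E. e \<subseteq> V \<and> card e = 2)"

definition vertex_degree :: "edge set \<Rightarrow> nat \<Rightarrow> nat" where
  "vertex_degree E v = card {e \<in> E. v \<in> e}"

definition max_degree :: "nat set \<Rightarrow> edge set \<Rightarrow> nat" where
  "max_degree V E = Max (vertex_degree E ` V)"

definition proper_edge_coloring :: "edge set \<Rightarrow> (edge \<Rightarrow> nat) \<Rightarrow> bool" where
  "proper_edge_coloring E col \<longleftrightarrow>
     (\<forall>e\<in>E. \<forall>e'\<in>E. e \<noteq> e' \<and> e \<inter> e' \<noteq> {} \<longrightarrow> col e \<noteq> col e')"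

text \<open>
  A deterministic online rule maps the list of edges that arrived earlier (oldest first) and the
  currently arriving edge to the color of the latter. The colors given to earlier edges are
  determined by the rule and the earlier edges, so they need not be passed as an argument.
\<close>
type_synonym online_rule = "edge list \<Rightarrow> edge \<Rightarrow> nat"

text \<open>
  A randomized online algorithm knows in advance only the number of nodes and the maximum degree,
  its first and second argument. Its internal randomness is the choice of a deterministic rule.
\<close>
type_synonym online_algorithm = "nat \<Rightarrow> nat \<Rightarrow> online_rule pmf"

definition online_coloring :: "online_rule \<Rightarrow> edge list \<Rightarrow> edge \<Rightarrow> nat" where
  "online_coloring f es e = f (takeWhile (\<lambda>e'. e' \<noteq> e) es) e"

text \<open>
  Properness is an unconditional requirement: it holds for every input graph, every arrival order
  and every outcome of the internal randomness. The palette is unbounded, and only the number of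
  colors used is subject to a probabilistic guarantee.
\<close>
definition online_edge_coloring_algorithm :: "online_algorithm \<Rightarrow> bool" where
  "online_edge_coloring_algorithm A \<longleftrightarrow>
     (\<forall>V E. \<forall>f \<in> set_pmf (A (card V) (max_degree V E)). \<forall>es \<in> permutations_of_set E.
        simple_graph V E \<longrightarrow> proper_edge_coloring E (online_coloring f es))"

definition random_order_run :: "online_algorithm \<Rightarrow> nat set \<Rightarrow> edge set \<Rightarrow> (edge \<Rightarrow> nat) pmf" where
  "random_order_run A V E =
     map_pmf (\<lambda>(f, es). online_coloring f es)
       (pair_pmf (A (card V) (max_degree V E)) (pmf_of_set (permutations_of_set E)))"

definition color_bound :: "real \<Rightarrow> real \<Rightarrow> nat \<Rightarrow> nat \<Rightarrow> real" where
  "color_bound C \<gamma> n d = real d + C * real d powr \<gamma> * ln (real n) powr (1 - \<gamma>)"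

end

theory Submission
  imports Defs
begin

text \<open>
  No randomness of the arrival order is needed: the bound holds for every fixed order. Every node
  \<open>v\<close> carries a weight \<open>y v k\<close> for each color \<open>k\<close>, initially 1, and
  an arriving edge \<open>uv\<close> gets color \<open>k\<close> with some probability
  \<open>p k \<le> \<kappa> * y u k * y v k\<close>, where \<open>\<kappa>\<close> is about
  \<open>1 / N\<close>. If \<open>k\<close> was chosen then \<open>y u k\<close> and \<open>y v k\<close> drop to 0,
  otherwise they are divided by \<open>1 - p k\<close>, so all weights are martingales. A suitable
  \<open>p\<close> exists as long as the mass \<open>\<Sum>k. y u k * y v k\<close>, a martingale starting
  at \<open>N\<close>, stays close to \<open>N\<close>. The weights stay bounded because
  \<open>1 / y u k\<close> decreases at the arrival of \<open>uv\<close> by at most \<open>\<kappa> * y v k\<close>;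
  the total decrease is therefore controlled by the sum of the weights of the neighbors of
  \<open>u\<close> at the arrival of the connecting edges, which again is a martingale and starts at the
  degree of \<open>u\<close>. Exponential moments of both kinds of martingales add up to a potential that
  is a supermartingale, is at least 1 before the first failure, and is initially tiny.
\<close>

section \<open>Exponential moments of one random color\<close>

text \<open>For \<open>x = - t\<close> below 0 it follows from \<open>1 + t \<le> exp t\<close> and
  the factorization of \<open>1 + t ^ 3\<close> by \<open>1 + t\<close>. The assumption is
  one-sided, so large negative deviations are covered.\<close>

lemma exp_le_quadratic:
  fixes x :: real
  assumes "x \<le> 1"
  shows "exp x \<le> 1 + x + x\<^sup>2"
proof (cases "0 \<le> x")
  case True
  then show ?thesis using assms by (rule exp_bound)
next
  case False
  define t where "t = - x"
  have t: "0 < t" using False by (simp add: t_def)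
  have "(1 - t + t\<^sup>2) * (1 + t) = 1 + t ^ 3"
    by (simp add: algebra_simps power2_eq_square power3_eq_cube)
  with t have "1 \<le> (1 - t + t\<^sup>2) * (1 + t)" by simp
  then have "1 / (1 + t) \<le> 1 - t + t\<^sup>2"
    using t by (simp add: pos_divide_le_eq)
  moreover have "exp x = 1 / exp t" by (simp add: t_def exp_minus field_simps)
  moreover have "1 / exp t \<le> 1 / (1 + t)"
    using t exp_ge_add_one_self[of t] by (intro divide_left_mono) auto
  ultimately show ?thesis by (simp add: t_def)
qed

text \<open>Under the expectation the linear term of the quadratic bound vanishes. Passing from 1 +
  v to exp v gives a factor that the exponents of the potential can absorb.\<close>

lemma expectation_exp_le:
  fixes X :: "'a \<Rightarrow> real"
  assumes fin: "finite (set_pmf q)"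
    and mean: "measure_pmf.expectation q X = 0"
    and le1: "\<And>c. c \<in> set_pmf q \<Longrightarrow> X c \<le> 1"
    and var: "measure_pmf.expectation q (\<lambda>c. (X c)\<^sup>2) \<le> v"
  shows "measure_pmf.expectation q (\<lambda>c. exp (X c)) \<le> exp v"
proof -
  note [simp] = integrable_measure_pmf_finite[OF fin]
  have "measure_pmf.expectation q (\<lambda>c. exp (X c)) \<le> measure_pmf.expectation q (\<lambda>c. 1 + X c + (X c)\<^sup>2)"
    by (intro integral_mono_AE) (auto simp: AE_measure_pmf_iff intro!: exp_le_quadratic le1)
  also have "\<dots> = 1 + measure_pmf.expectation q (\<lambda>c. (X c)\<^sup>2)"
    using mean by simp
  also have "\<dots> \<le> 1 + v" using var by simp
  also have "\<dots> \<le> exp v" by (rule exp_ge_add_one_self)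
  finally show ?thesis .
qed

text \<open>Give every c as many slots as \<open>k c\<close> says and inject the L seeds into the
  slots; forgetting the slot number leaves the required map.\<close>

lemma exists_function_with_fibre_bounds:
  fixes k :: "'a \<Rightarrow> nat"
  assumes "finite C" "L \<le> (\<Sum>c\<in>C. k c)"
  shows "\<exists>g. (\<forall>s<L. g s \<in> C) \<and> (\<forall>c\<in>C. card {s. s < L \<and> g s = c} \<le> k c)"
proof -
  let ?S = "Sigma C (\<lambda>c. {..<k c})"
  have fin: "finite ?S" using assms by auto
  have "card {..<L} \<le> card ?S" using assms by simp
  then obtain h where h: "h ` {..<L} \<subseteq> ?S" "inj_on h {..<L}"
    using card_le_inj[OF finite_lessThan fin] by blast
  have "card {s. s < L \<and> fst (h s) = c} \<le> k c" if "c \<in> C" for c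
  proof -
    have "card {s. s < L \<and> fst (h s) = c} = card (h ` {s. s < L \<and> fst (h s) = c})"
      by (rule card_image[symmetric]) (rule inj_on_subset[OF h(2)], auto)
    also have "\<dots> \<le> card ({c} \<times> {..<k c})"
      using h(1) by (intro card_mono) fastforce+
    finally show ?thesis by simp
  qed
  moreover have "\<forall>s<L. fst (h s) \<in> C" using h(1) by fastforce
  ultimately show ?thesis by (intro exI[of _ "fst \<circ> h"]) auto
qed

text \<open>The relative change of a weight: when color c is drawn, the weight of k at an end of the
  arriving edge is multiplied by \<open>1 + jump q k c\<close>.\<close>

definition jump :: "nat pmf \<Rightarrow> nat \<Rightarrow> nat \<Rightarrow> real" where
  "jump q k c = (if c = k then -1 else pmf q k / (1 - pmf q k))"

lemma expectation_two_valued: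
  fixes a b :: real
  shows "measure_pmf.expectation q (\<lambda>c. if c = k then a else b) = pmf q k * a + (1 - pmf q k) * b"
proof -
  have "measure_pmf.expectation q (\<lambda>c. if c = k then a else b)
      = measure_pmf.expectation q (\<lambda>c. b + (a - b) * indicator {k} c)"
    by (intro Bochner_Integration.integral_cong) auto
  also have "\<dots> = b + (a - b) * pmf q k"
    by (subst Bochner_Integration.integral_add)
      (auto simp: measure_pmf_single intro!: integrable_mult_right
        measure_pmf.integrable_const_bound[where B=1])
  finally show ?thesis by (simp add: algebra_simps)
qed

lemma expectation_jump:
  assumes "pmf q k < 1"
  shows "measure_pmf.expectation q (jump q k) = 0"
  using assms unfolding jump_def[abs_def] by (simp add: expectation_two_valued)

lemma expectation_jump_square_le:
  assumes "pmf q k \<le> 1/2"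
  shows "measure_pmf.expectation q (\<lambda>c. (jump q k c)\<^sup>2) \<le> 2 * pmf q k"
proof -
  let ?p = "pmf q k"
  have "measure_pmf.expectation q (\<lambda>c. (jump q k c)\<^sup>2)
      = measure_pmf.expectation q (\<lambda>c. if c = k then 1 else (?p / (1 - ?p))\<^sup>2)"
    unfolding jump_def by (intro Bochner_Integration.integral_cong) auto
  also have "\<dots> = ?p + (1 - ?p) * (?p / (1 - ?p))\<^sup>2"
    by (simp add: expectation_two_valued)
  also have "\<dots> = ?p / (1 - ?p)" 
  proof -
    have "1 - ?p \<noteq> 0" using assms by auto
    then show ?thesis by (simp add: divide_simps power2_eq_square) (simp add: algebra_simps)
  qed
  also have "\<dots> \<le> ?p / (1/2)"
    using assms by (intro divide_left_mono) auto
  finally show ?thesis by simp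
qed

lemma abs_jump_le:
  assumes "pmf q k \<le> 1/2"
  shows "\<bar>jump q k c\<bar> \<le> (if c = k then 1 else 2 * pmf q k)"
proof -
  have "pmf q k / (1 - pmf q k) \<le> pmf q k / (1/2)"
    using assms by (intro divide_left_mono) auto
  then show ?thesis using assms by (auto simp: jump_def)
qed

lemma expectation_exp_jump_le:
  assumes fin: "finite (set_pmf q)" and p: "pmf q k \<le> 1/2"
    and a: "\<bar>a\<bar> \<le> 1"
  shows "measure_pmf.expectation q (\<lambda>c. exp (a * jump q k c)) \<le> exp (2 * a\<^sup>2 * pmf q k)"
proof (rule expectation_exp_le[OF fin])
  show "measure_pmf.expectation q (\<lambda>c. a * jump q k c) = 0"
    using expectation_jump[of q k] p by simp
  show "a * jump q k c \<le> 1" for c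
  proof -
    have "\<bar>jump q k c\<bar> \<le> 1" using abs_jump_le[OF p, of c] p by (auto split: if_splits)
    with a have "\<bar>a * jump q k c\<bar> \<le> 1" by (simp add: abs_mult mult_le_one)
    then show ?thesis by linarith
  qed
  show "measure_pmf.expectation q (\<lambda>c. (a * jump q k c)\<^sup>2) \<le> 2 * a\<^sup>2 * pmf q k"
    using mult_left_mono[OF expectation_jump_square_le[OF p], of "a\<^sup>2"]
    by (simp add: power_mult_distrib mult_ac)
qed

text \<open>All jumps stem from one draw. The drawn color contributes at most a, and the terms 2 * a
  * p of all colors add up to 2 * a because the probabilities sum to 1. This sure bound 3 * a also
  bounds the variance.\<close>

lemma expectation_exp_jump_sum_le:
  fixes w :: "nat \<Rightarrow> real"
  assumes supp: "set_pmf q \<subseteq> {..<N}" and p: "\<And>k. k < N \<Longrightarrow> pmf q k \<le> 1/2"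
    and w: "\<And>k. k < N \<Longrightarrow> \<bar>w k\<bar> \<le> a" and a: "3 * a \<le> 1"
  shows "measure_pmf.expectation q (\<lambda>c. exp (\<Sum>k<N. w k * jump q k c)) \<le> exp (9 * a\<^sup>2)"
proof -
  have fin: "finite (set_pmf q)" using supp finite_subset by blast
  note [simp] = integrable_measure_pmf_finite[OF fin]
  let ?X = "\<lambda>c. \<Sum>k<N. w k * jump q k c"
  have bound: "\<bar>?X c\<bar> \<le> 3 * a" if "c \<in> set_pmf q" for c
  proof -
    have c: "c < N" using that supp by auto
    have a0: "0 \<le> a" using w[OF c] by linarith
    have "\<bar>?X c\<bar> \<le> (\<Sum>k<N. \<bar>w k\<bar> * \<bar>jump q k c\<bar>)"
      by (rule order_trans[OF sum_abs]) (simp add: abs_mult)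
    also have "\<dots> \<le> (\<Sum>k<N. a * ((if c = k then 1 else 0) + 2 * pmf q k))"
    proof (intro sum_mono mult_mono)
      fix k assume "k \<in> {..<N}"
      then show "\<bar>jump q k c\<bar> \<le> (if c = k then 1 else 0) + 2 * pmf q k"
        using abs_jump_le[OF p, of k c] by (cases "c = k") (auto intro: order_trans[of _ 1])
    qed (use w a0 in auto)
    also have "\<dots> = a * (1 + 2 * (\<Sum>k<N. pmf q k))"
      using c by (simp add: sum_distrib_left[symmetric] sum.distrib)
    also have "(\<Sum>k<N. pmf q k) = 1" using supp by (intro sum_pmf_eq_1) auto
    finally show ?thesis by simp
  qed
  show ?thesis
  proof (rule expectation_exp_le[OF fin])
    show "measure_pmf.expectation q ?X = 0"
    proof (subst Bochner_Integration.integral_sum)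
      show "(\<Sum>k<N. measure_pmf.expectation q (\<lambda>c. w k * jump q k c)) = 0"
      proof (intro sum.neutral ballI)
        fix k assume "k \<in> {..<N}"
        then have "pmf q k < 1" using p[of k] by auto
        then show "measure_pmf.expectation q (\<lambda>c. w k * jump q k c) = 0"
          using expectation_jump[of q k] by simp
      qed
    qed simp
    show "?X c \<le> 1" if "c \<in> set_pmf q" for c using bound[OF that] a by linarith
    have "measure_pmf.expectation q (\<lambda>c. (?X c)\<^sup>2) \<le> measure_pmf.expectation q (\<lambda>c. (3 * a)\<^sup>2)"
    proof (intro integral_mono_AE, simp, simp, unfold AE_measure_pmf_iff, intro ballI)
      fix c assume "c \<in> set_pmf q"
      from bound[OF this] show "(?X c)\<^sup>2 \<le> (3 * a)\<^sup>2"
        by (metis abs_ge_zero power2_abs power_mono)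
    qed
    then show "measure_pmf.expectation q (\<lambda>c. (?X c)\<^sup>2) \<le> 9 * a\<^sup>2"
      by (simp add: power_mult_distrib)
  qed
qed

section \<open>The online rule\<close>

lemma zip_take_left: "zip (take n xs) ys = take n (zip xs ys)"
  by (induction xs arbitrary: n ys) (auto simp: zip_Cons1 take_Cons' split: list.splits)

lemma takeWhile_neq_nth:
  assumes "distinct xs" "i < length xs"
  shows "takeWhile (\<lambda>x. x \<noteq> xs ! i) xs = take i xs"
  using assms by (intro takeWhile_eq_take_P_nth) (auto simp: nth_eq_iff_index_eq)

text \<open>\<open>N\<close> is the size of the regular palette, \<open>L\<close> the number of
  values of a seed, and \<open>\<kappa>\<close> scales the color probabilities. Properness is proved
  here, for every choice of these parameters with a positive L.\<close>

locale edge_palette =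
  fixes N L :: nat and \<kappa> :: real
  assumes L_pos: "0 < L"
begin

definition weight :: "(nat \<Rightarrow> nat \<Rightarrow> real) \<Rightarrow> edge \<Rightarrow> nat \<Rightarrow> real" where
  "weight y e k = (\<Prod>v\<in>e. y v k)"

text \<open>
  The internal randomness has to be a discrete distribution on rules fixed in advance, whereas the
  probabilities needed for an edge depend on the history. Hence every edge consumes a uniform seed
  below \<open>L\<close>, and the probabilities are rounded down to multiples of \<open>1 / L\<close>.
\<close>
definition quota :: "(nat \<Rightarrow> nat \<Rightarrow> real) \<Rightarrow> edge \<Rightarrow> nat \<Rightarrow> nat" where
  "quota y e k = nat \<lfloor>\<kappa> * real L * weight y e k\<rfloor>"

text \<open>The discrete form of total probability at least 1: the quotas offer enough slots for all
  seeds.\<close>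

definition feasible :: "(nat \<Rightarrow> nat \<Rightarrow> real) \<Rightarrow> edge \<Rightarrow> bool" where
  "feasible y e \<longleftrightarrow> L \<le> (\<Sum>k<N. quota y e k)"

text \<open>\<open>SOME\<close> fixes one assignment per weight table and edge, so the weights can
  be recomputed from the earlier edges and their seeds.\<close>

definition pick :: "(nat \<Rightarrow> nat \<Rightarrow> real) \<Rightarrow> edge \<Rightarrow> nat \<Rightarrow> nat" where
  "pick y e = (SOME g. (\<forall>s<L. g s \<in> {..<N}) \<and>
     (\<forall>k\<in>{..<N}. card {s. s < L \<and> g s = k} \<le> quota y e k))"

definition color_pmf :: "(nat \<Rightarrow> nat \<Rightarrow> real) \<Rightarrow> edge \<Rightarrow> nat pmf" where
  "color_pmf y e = map_pmf (pick y e) (pmf_of_set {..<L})"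

text \<open>The divisor uses the probability after rounding, not its target. Hence the mean is
  preserved without rounding error as long as this probability is below 1.\<close>

definition reweight :: "nat pmf \<Rightarrow> edge \<Rightarrow> nat \<Rightarrow> (nat \<Rightarrow> nat \<Rightarrow> real) \<Rightarrow> nat \<Rightarrow> nat \<Rightarrow> real" where
  "reweight q e c y = (\<lambda>v k. if v \<in> e then (if k = c then 0 else y v k / (1 - pmf q k)) else y v k)"

definition step :: "(nat \<Rightarrow> nat \<Rightarrow> real) \<Rightarrow> edge \<times> nat \<Rightarrow> nat \<Rightarrow> nat \<Rightarrow> real" where
  "step y = (\<lambda>(e, s). if feasible y e then reweight (color_pmf y e) e (pick y e s) y else y)"

text \<open>\<open>zip\<close> stops at the shorter list, so a prefix of the arrivals reads only its
  own seeds even though the full seed list is passed.\<close>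

definition state :: "edge list \<Rightarrow> nat list \<Rightarrow> nat \<Rightarrow> nat \<Rightarrow> real" where
  "state es ss = foldl step (\<lambda>_ _. 1) (zip es ss)"

text \<open>An infeasible edge receives a reserve color determined by its arrival time. It differs
  from all palette colors and all other reserve colors, which keeps the coloring proper after a
  failure.\<close>

definition palette_rule :: "nat list \<Rightarrow> online_rule" where
  "palette_rule ss es e = (let y = state es ss in
     if feasible y e then pick y e (ss ! length es) else N + length es)"

section \<open>Properness for every arrival order\<close>

lemma pick_spec:
  assumes "feasible y e"
  shows "(\<forall>s<L. pick y e s \<in> {..<N}) \<and> (\<forall>k\<in>{..<N}. card {s. s < L \<and> pick y e s = k} \<le> quota y e k)"
proof -
  have "L \<le> (\<Sum>k\<in>{..<N}. quota y e k)" using assms by (simp add: feasible_def)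
  from someI_ex[OF exists_function_with_fibre_bounds[OF finite_lessThan this]]
  show ?thesis unfolding pick_def .
qed

lemma pick_less: "feasible y e \<Longrightarrow> s < L \<Longrightarrow> pick y e s < N"
  using pick_spec by auto

text \<open>A zero weight at one end makes the product and therefore the quota zero, and then no
  seed is mapped to that color.\<close>

lemma pick_available:
  assumes "feasible y e" "s < L" "finite e" "v \<in> e"
  shows "y v (pick y e s) \<noteq> 0"
proof
  assume 0: "y v (pick y e s) = 0"
  then have "weight y e (pick y e s) = 0"
    using assms by (auto simp: weight_def)
  then have "quota y e (pick y e s) = 0" by (simp add: quota_def)
  moreover have "card {s'. s' < L \<and> pick y e s' = pick y e s} \<le> quota y e (pick y e s)"
    using pick_spec[OF assms(1)] pick_less[OF assms(1,2)] by blast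
  ultimately have "card {s'. s' < L \<and> pick y e s' = pick y e s} = 0" by simp
  then show False using assms(2) by auto
qed

lemma set_color_pmf: "feasible y e \<Longrightarrow> set_pmf (color_pmf y e) \<subseteq> {..<N}"
  using L_pos by (auto simp: color_pmf_def pick_less set_pmf_of_set lessThan_empty_iff)

lemma pmf_color_pmf_le:
  assumes "feasible y e" "0 \<le> \<kappa> * weight y e k"
  shows "pmf (color_pmf y e) k \<le> \<kappa> * weight y e k"
proof (cases "k < N")
  case True
  have "pmf (color_pmf y e) k = card {s. s < L \<and> pick y e s = k} / L"
    unfolding color_pmf_def pmf_map using L_pos
    by (subst measure_pmf_of_set) (auto simp: Int_def vimage_def)
  also have "\<dots> \<le> quota y e k / L"
    using pick_spec[OF assms(1)] True by (intro divide_right_mono) auto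
  also have "real (quota y e k) \<le> \<kappa> * weight y e k * L"
    unfolding quota_def using assms(2) 
    by (metis mult.assoc mult.commute of_nat_0_le_iff of_nat_floor split_mult_pos_le)
  then have "quota y e k / L \<le> \<kappa> * weight y e k"
    using L_pos by (simp add: pos_divide_le_eq)
  finally show ?thesis .
next
  case False
  then have "k \<notin> set_pmf (color_pmf y e)" using set_color_pmf[OF assms(1)] by auto
  then show ?thesis using assms(2) by (simp add: set_pmf_iff)
qed

text \<open>Updates only divide a weight or set it to 0, so 0 is absorbing and permanently marks a
  color as used at the node.\<close>

lemma foldl_step_zero: "y v k = 0 \<Longrightarrow> foldl step y xs v k = 0"
  by (induction xs arbitrary: y) (auto simp: step_def reweight_def)

lemma state_used_color:
  assumes i: "i < length es" "i < length ss" and v: "v \<in> es ! i"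
    and feas: "feasible (state (take i es) ss) (es ! i)"
  shows "state es ss v (palette_rule ss (take i es) (es ! i)) = 0"
proof -
  let ?k = "palette_rule ss (take i es) (es ! i)"
  let ?y = "state (take i es) ss"
  have k: "?k = pick ?y (es ! i) (ss ! i)"
    using i feas by (simp add: palette_rule_def)
  have "state es ss = foldl step (\<lambda>_ _. 1) (take i (zip es ss) @ zip es ss ! i # drop (Suc i) (zip es ss))"
    unfolding state_def using i by (subst id_take_nth_drop[of i "zip es ss"]) auto
  also have "\<dots> = foldl step (step ?y (es ! i, ss ! i)) (drop (Suc i) (zip es ss))"
    using i by (simp add: state_def zip_take_left)
  finally show ?thesis
    using v feas k by (auto intro!: foldl_step_zero simp: step_def reweight_def)
qed

lemma palette_rule_proper:
  assumes dist: "distinct es" and fin: "\<And>e. e \<in> set es \<Longrightarrow> finite e"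
    and ss: "length es \<le> length ss" "set ss \<subseteq> {..<L}"
  shows "proper_edge_coloring (set es) (online_coloring (palette_rule ss) es)"
proof -
  let ?col = "\<lambda>i. palette_rule ss (take i es) (es ! i)"
  have col: "online_coloring (palette_rule ss) es (es ! i) = ?col i" if "i < length es" for i
    using that dist by (simp add: online_coloring_def takeWhile_neq_nth)
  have seed: "ss ! i < L" if "i < length es" for i
    using that ss by (metis lessThan_iff nth_mem order_less_le_trans subsetD)
  have less: "?col i < N" if "feasible (state (take i es) ss) (es ! i)" "i < length es" for i
    using that seed[of i] by (auto simp: palette_rule_def intro!: pick_less)
  \<comment> \<open>Two palette colors differ because at the arrival of j the color of i has weight
    0 at v and the color of j does not. A palette color lies below N and a reserve color does not;
    two reserve colors have different arrival times.\<close>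
  have neq: "?col i \<noteq> ?col j" if ij: "i < j" "j < length es" and v: "v \<in> es ! i" "v \<in> es ! j" for i j v
  proof (cases "feasible (state (take j es) ss) (es ! j)")
    case feas_j: True
    show ?thesis
    proof (cases "feasible (state (take i es) ss) (es ! i)")
      case True
      have "state (take j es) ss v (?col i) = 0"
        using state_used_color[of i "take j es" ss v] True ij v ss by (simp add: min_def)
      moreover have "state (take j es) ss v (?col j) \<noteq> 0"
        using feas_j ij v fin seed[of j] pick_available[OF feas_j, of "ss ! j" v] 
        by (simp add: palette_rule_def)
      ultimately show ?thesis by metis
    next
      case False
      then have "N \<le> ?col i" by (simp add: palette_rule_def)
      then show ?thesis using less[OF feas_j ij(2)] by linarith
    qed
  next
    case False
    then have j: "?col j = N + j" using ij by (simp add: palette_rule_def)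
    show ?thesis
    proof (cases "feasible (state (take i es) ss) (es ! i)")
      case True
      from less[OF this] ij j show ?thesis by simp
    next
      case False
      then show ?thesis using ij j by (simp add: palette_rule_def)
    qed
  qed
  have "online_coloring (palette_rule ss) es e \<noteq> online_coloring (palette_rule ss) es e'"
    if ee: "e \<in> set es" "e' \<in> set es" "e \<noteq> e'" "e \<inter> e' \<noteq> {}" for e e'
  proof -
    obtain v where v: "v \<in> e" "v \<in> e'" using ee(4) by blast
    obtain i j where i: "i < length es" "e = es ! i" and j: "j < length es" "e' = es ! j"
      using ee(1,2) by (auto simp: in_set_conv_nth)
    then consider "i < j" | "j < i" using ee(3) by (metis nat_neq_iff)
    then show ?thesis
    proof cases
      case 1
      then show ?thesis using neq[of i j v] i j v col by simp
    next
      case 2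
      then show ?thesis using neq[of j i v] i j v col by (simp add: eq_commute)
    qed
  qed
  then show ?thesis unfolding proper_edge_coloring_def by blast
qed

text \<open>One seed is consumed per edge, matching the unfolding of \<open>replicate_pmf\<close>;
  running out of seeds counts as failure.\<close>

fun succeeds :: "(nat \<Rightarrow> nat \<Rightarrow> real) \<Rightarrow> edge list \<Rightarrow> nat list \<Rightarrow> bool" where
  "succeeds y [] ss = True"
| "succeeds y (e # es) [] = False"
| "succeeds y (e # es) (s # ss) = (feasible y e \<and> succeeds (step y (e, s)) es ss)"

lemma succeeds_feasible:
  "succeeds y es ss \<Longrightarrow> i < length es \<Longrightarrow> feasible (foldl step y (zip (take i es) ss)) (es ! i)"
  by (induction y es ss arbitrary: i rule: succeeds.induct) (auto simp: less_Suc_eq_0_disj)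

lemma card_colors_le:
  assumes "succeeds (\<lambda>_ _. 1) es ss" "distinct es"
    and ss: "length es \<le> length ss" "set ss \<subseteq> {..<L}"
  shows "card (online_coloring (palette_rule ss) es ` set es) \<le> N"
proof -
  have "online_coloring (palette_rule ss) es (es ! i) < N" if i: "i < length es" for i
  proof -
    have "ss ! i \<in> set ss" using i ss by simp
    then have "ss ! i < L" using ss(2) by auto
    then show ?thesis
      using succeeds_feasible[OF assms(1) i] i assms(2)
      by (auto simp: online_coloring_def takeWhile_neq_nth palette_rule_def state_def min_def intro!: pick_less)
  qed
  then have "online_coloring (palette_rule ss) es ` set es \<subseteq> {..<N}"
    by (auto simp: in_set_conv_nth)
  then show ?thesis by (metis card_lessThan card_mono finite_lessThan)
qed

end

section \<open>Supermartingale analysis\<close>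

lemma prob_bind_pmf_of_set:
  fixes f :: "'a \<Rightarrow> 'b pmf"
  assumes "A \<noteq> {}" "finite A" "\<And>x. x \<in> A \<Longrightarrow> finite (set_pmf (f x))"
  shows "measure_pmf.prob (pmf_of_set A \<bind> f) X
      = measure_pmf.expectation (pmf_of_set A) (\<lambda>x. measure_pmf.prob (f x) X)"
  using pmf_expectation_bind_pmf_of_set[OF assms, where h = "indicator X :: 'b \<Rightarrow> real"] assms(1,2)
  by (simp add: integral_pmf_of_set sum_divide_distrib inverse_eq_divide)

lemma finite_set_replicate_pmf: "finite (set_pmf p) \<Longrightarrow> finite (set_pmf (replicate_pmf m p))"
  unfolding set_replicate_pmf by (simp add: lists_eq_set finite_lists_length_eq)

definition nbrs :: "edge set \<Rightarrow> nat \<Rightarrow> nat set" where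
  "nbrs S u = {v. {u, v} \<in> S}"

text \<open>The surplus \<epsilon> is shared out as follows. The factor 1 + \<epsilon>/4 in \<kappa>
  leaves room for a mass loss of \<epsilon>/8 and, through \<open>L_ge\<close>, a rounding loss of
  \<epsilon>/16. Loads may exceed \<Delta> by a factor 1 + \<epsilon>/4. \<open>N_large\<close>
  keeps each color probability at most 1/2 while the weights are bounded by B.\<close>

locale palette_analysis = edge_palette +
  fixes V :: "nat set" and E :: "edge set" and \<Delta> :: nat and \<epsilon> :: real
  assumes graph: "simple_graph V E"
    and degree_le: "\<And>v. v \<in> V \<Longrightarrow> vertex_degree E v \<le> \<Delta>"
    and eps: "0 < \<epsilon>" "\<epsilon> \<le> 1/2"
    and N_ge: "(1 + \<epsilon>) * real \<Delta> \<le> real N"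
    and N_large: "64 / \<epsilon>\<^sup>2 \<le> real N"
    and L_ge: "16 * real N / \<epsilon> \<le> real L"
    and \<kappa>_eq: "\<kappa> = (1 + \<epsilon> / 4) / real N"
begin

text \<open>B is the cap on the weights. \<alpha> and \<mu> are chosen so that the variance cost of
  all arrivals uses up half of the initial margin in the exponent, which is \<alpha> * \<epsilon> *
  \<Delta> / 4 for loads and \<mu> * \<epsilon> * N / 8 for masses.\<close>

definition B :: real where "B = 4 / \<epsilon>"
definition \<alpha> :: real where "\<alpha> = \<epsilon> / (128 * B ^ 4)"
definition \<mu> :: real where "\<mu> = \<epsilon> / (288 * B ^ 4)"

text \<open>
  \<open>A u k\<close> is the sum of the weights \<open>y v k\<close> that the neighbors \<open>v\<close>
  of \<open>u\<close> had at the arrival of \<open>{u, v}\<close>. It is used in the analysis only, and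
  \<open>S\<close> is the set of edges still to arrive.
\<close>
definition load :: "(nat \<Rightarrow> nat \<Rightarrow> real) \<Rightarrow> (nat \<Rightarrow> nat \<Rightarrow> real) \<Rightarrow> edge set \<Rightarrow> nat \<Rightarrow> nat \<Rightarrow> real" where
  "load y A S u k = A u k + (\<Sum>v\<in>nbrs S u. y v k)"

definition mass :: "(nat \<Rightarrow> nat \<Rightarrow> real) \<Rightarrow> edge \<Rightarrow> real" where
  "mass y e = (\<Sum>k<N. weight y e k)"

text \<open>The weights are those before the update by e. With this choice the arrival of an edge at
  u leaves the load of u unchanged.\<close>

definition charge :: "edge \<Rightarrow> (nat \<Rightarrow> nat \<Rightarrow> real) \<Rightarrow> (nat \<Rightarrow> nat \<Rightarrow> real) \<Rightarrow> nat \<Rightarrow> nat \<Rightarrow> real" where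
  "charge e y A = (\<lambda>u k. A u k + (if u \<in> e then \<Sum>v\<in>e - {u}. y v k else 0))"

text \<open>Zero stands for a used color. For the other colors the reciprocal is tracked because it
  changes additively, which makes its total decrease a sum over the arrivals at u.\<close>

definition valid :: "(nat \<Rightarrow> nat \<Rightarrow> real) \<Rightarrow> (nat \<Rightarrow> nat \<Rightarrow> real) \<Rightarrow> bool" where
  "valid y A \<longleftrightarrow> (\<forall>u k. y u k = 0 \<or> 1 \<le> y u k \<and> 1 - \<kappa> * A u k \<le> 1 / y u k)"

text \<open>
  The cardinalities count the remaining arrivals that can change the martingale: each of them costs
  at most the factor in front of the cardinality.
\<close>
definition load_term :: "(nat \<Rightarrow> nat \<Rightarrow> real) \<Rightarrow> (nat \<Rightarrow> nat \<Rightarrow> real) \<Rightarrow> edge set \<Rightarrow> nat \<Rightarrow> nat \<Rightarrow> real" where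
  "load_term y A S u k = exp (\<alpha> * (load y A S u k - (1 + \<epsilon> / 4) * real \<Delta>)
     + 16 * \<alpha>\<^sup>2 * B ^ 4 / real N * real (card {g \<in> S. g \<inter> nbrs E u \<noteq> {}}))"

definition mass_term :: "(nat \<Rightarrow> nat \<Rightarrow> real) \<Rightarrow> edge set \<Rightarrow> edge \<Rightarrow> real" where
  "mass_term y S f = exp (\<mu> * ((1 - \<epsilon> / 8) * real N - mass y f)
     + 9 * \<mu>\<^sup>2 * B ^ 4 * real (card {g \<in> S. g \<inter> f \<noteq> {}}))"

text \<open>A union bound in exponential form: a term is at least 1 as soon as the load in question
  reaches its threshold, or the mass of an uncolored edge falls to its own.\<close>

definition potential :: "(nat \<Rightarrow> nat \<Rightarrow> real) \<Rightarrow> (nat \<Rightarrow> nat \<Rightarrow> real) \<Rightarrow> edge set \<Rightarrow> real" where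
  "potential y A S = (\<Sum>u\<in>V. \<Sum>k<N. load_term y A S u k) + (\<Sum>f\<in>S. mass_term y S f)"

section \<open>Graph facts and parameter bounds\<close>

lemma N_pos: "0 < real N"
  using eps by (intro less_le_trans[OF _ N_large]) simp

lemma finite_V: "finite V" using graph by (simp add: simple_graph_def)

lemma finite_E: "finite E"
proof (rule finite_subset)
  show "E \<subseteq> Pow V" using graph by (auto simp: simple_graph_def)
  show "finite (Pow V)" using finite_V by simp
qed

lemma edge_card: "e \<in> E \<Longrightarrow> card e = 2"
  and edge_subset: "e \<in> E \<Longrightarrow> e \<subseteq> V"
  using graph unfolding simple_graph_def by simp_all

lemma edgeE:
  assumes "e \<in> E"
  obtains u v where "e = {u, v}" "u \<noteq> v" "u \<in> V" "v \<in> V"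
proof -
  obtain u v where "e = {u, v}" "u \<noteq> v" using edge_card[OF assms] by (meson card_2_iff)
  with edge_subset[OF assms] show ?thesis using that by blast
qed

lemma nbrs_neq:
  assumes "S \<subseteq> E" "v \<in> nbrs S u"
  shows "u \<noteq> v"
proof
  have "{u, v} \<in> E" using assms unfolding nbrs_def by blast
  moreover assume "u = v"
  ultimately show False using edge_card[of "{u, v}"] by simp
qed

lemma nbrs_subset:
  assumes "S \<subseteq> E"
  shows "nbrs S u \<subseteq> V"
proof
  fix v assume "v \<in> nbrs S u"
  then have "{u, v} \<in> E" using assms unfolding nbrs_def by blast
  then show "v \<in> V" using edge_subset[of "{u, v}"] by simp
qed

lemma finite_nbrs: "S \<subseteq> E \<Longrightarrow> finite (nbrs S u)"
  by (rule finite_subset[OF nbrs_subset finite_V])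

lemma kappa_pos: "0 < \<kappa>" using N_pos eps by (simp add: \<kappa>_eq)

lemma kappa_le: "\<kappa> \<le> 2 / real N"
  unfolding \<kappa>_eq using N_pos eps by (intro divide_right_mono) auto

lemma B_pos: "0 < B" using eps by (simp add: B_def)

lemma kappa_B_le: "\<kappa> * B\<^sup>2 \<le> 1/2"
proof -
  have "\<kappa> * B\<^sup>2 \<le> 2 / real N * B\<^sup>2"
    using kappa_le by (intro mult_right_mono) auto
  also have "\<dots> = 32 / \<epsilon>\<^sup>2 / real N" by (simp add: B_def power_divide)
  also have "\<dots> \<le> 1/2"
    using N_large by (subst pos_divide_le_eq[OF N_pos]) simp
  finally show ?thesis .
qed

section \<open>Consequences of the weight invariant\<close>

lemma valid_nonneg:
  assumes "valid y A"
  shows "0 \<le> y u k"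
proof -
  have "y u k = 0 \<or> 1 \<le> y u k" using assms unfolding valid_def by blast
  then show ?thesis by linarith
qed

lemma weight_nonneg: "valid y A \<Longrightarrow> 0 \<le> weight y e k"
  unfolding weight_def by (intro prod_nonneg ballI valid_nonneg)

text \<open>The load bounds \<open>A u k\<close>, so \<open>\<kappa> * A u k\<close> is at most (1 +
  \<epsilon>/4)^2 * \<Delta> / N, which is at most 1 - \<epsilon>/4. By the invariant the reciprocal
  of a nonzero weight is at least \<epsilon>/4.\<close>

lemma state_le_B:
  assumes "valid y A" "S \<subseteq> E" "load y A S u k < (1 + \<epsilon> / 4) * real \<Delta>"
  shows "y u k \<le> B"
proof (cases "y u k = 0")
  case False
  have "A u k \<le> load y A S u k"
    unfolding load_def using valid_nonneg[OF assms(1)] by (simp add: sum_nonneg)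
  then have A: "A u k \<le> (1 + \<epsilon> / 4) * real \<Delta>" using assms(3) by linarith
  have "(1 - \<epsilon> / 4) * (1 + \<epsilon>) - (1 + \<epsilon> / 4) * (1 + \<epsilon> / 4) = \<epsilon> * (1 / 4 - \<epsilon> * 5 / 16)"
    by (simp add: field_simps)
  also have "\<dots> \<ge> 0" using eps by (intro mult_nonneg_nonneg) auto
  finally have num: "(1 + \<epsilon> / 4) * (1 + \<epsilon> / 4) \<le> (1 - \<epsilon> / 4) * (1 + \<epsilon>)" by simp
  have "(1 + \<epsilon> / 4) * A u k \<le> (1 + \<epsilon> / 4) * ((1 + \<epsilon> / 4) * real \<Delta>)"
    using A eps by (intro mult_left_mono) auto
  also have "\<dots> \<le> (1 - \<epsilon> / 4) * ((1 + \<epsilon>) * real \<Delta>)"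
    using mult_right_mono[OF num, of "real \<Delta>"] by (simp only: mult.assoc)
  also have "\<dots> \<le> (1 - \<epsilon> / 4) * real N"
    using N_ge eps by (intro mult_left_mono) auto
  finally have "\<kappa> * A u k \<le> 1 - \<epsilon> / 4"
    using N_pos by (simp add: \<kappa>_eq pos_divide_le_eq)
  moreover from False assms(1) have y: "1 \<le> y u k" "1 - \<kappa> * A u k \<le> 1 / y u k"
    unfolding valid_def by blast+
  ultimately have "\<epsilon> / 4 \<le> 1 / y u k" by linarith
  then have "y u k * \<epsilon> \<le> 4" using y(1) by (simp add: field_simps)
  then show ?thesis unfolding B_def using eps by (simp add: field_simps)
qed (use B_pos in simp)

text \<open>The floors lose at most 1 per color, hence N in total, which is at most L * \<epsilon> /
  16. The product of 1 + \<epsilon>/4 and 1 - \<epsilon>/8 leaves exactly this much room.\<close>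

lemma feasible_if_mass:
  assumes "valid y A" "(1 - \<epsilon> / 8) * real N < mass y e"
  shows "feasible y e"
proof -
  have "(1 + \<epsilon> / 4) * (1 - \<epsilon> / 8) - (1 + \<epsilon> / 16) = \<epsilon> * (1 / 16 - \<epsilon> / 32)"
    by (simp add: field_simps)
  also have "\<dots> \<ge> 0" using eps by (intro mult_nonneg_nonneg) auto
  finally have num: "1 + \<epsilon> / 16 \<le> (1 + \<epsilon> / 4) * (1 - \<epsilon> / 8)" by simp
  have "real N \<le> real L * (\<epsilon> / 16)" using L_ge eps by (simp add: field_simps)
  then have "real L + real N \<le> real L * (1 + \<epsilon> / 16)" by (simp add: algebra_simps)
  also have "\<dots> \<le> real L * ((1 + \<epsilon> / 4) * (1 - \<epsilon> / 8))"
    using num by (intro mult_left_mono) auto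
  also have "\<dots> = \<kappa> * real L * ((1 - \<epsilon> / 8) * real N)"
    using N_pos by (simp add: \<kappa>_eq)
  also have "\<dots> \<le> \<kappa> * real L * mass y e"
    using assms(2) kappa_pos by (intro mult_left_mono) auto
  finally have "real L \<le> \<kappa> * real L * mass y e - real N" by simp
  also have "\<dots> = (\<Sum>k<N. \<kappa> * real L * weight y e k - 1)"
    by (simp add: mass_def sum_subtractf sum_distrib_left)
  also have "\<dots> \<le> (\<Sum>k<N. real (quota y e k))"
    unfolding quota_def by (intro sum_mono) linarith
  finally have "real L \<le> real (\<Sum>k<N. quota y e k)" by simp
  then show ?thesis unfolding feasible_def by linarith
qed

lemma reweight_eq_jump:
  assumes "pmf q k < 1"
  shows "reweight q e c y v k = (if v \<in> e then y v k * (1 + jump q k c) else y v k)"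
  using assms by (simp add: reweight_def jump_def field_simps)

text \<open>If e = {u, w} arrives and k is not drawn, the reciprocal at u drops by
  \<open>pmf q k / y u k\<close>. This is at most \<open>\<kappa> * y w k\<close>, the amount by
  which \<open>charge\<close> raises \<open>\<kappa> * A u k\<close>.\<close>

lemma valid_step:
  assumes "valid y A" "e \<in> E" "\<And>k. pmf q k \<le> \<kappa> * weight y e k"
  shows "valid (reweight q e c y) (charge e y A)"
  unfolding valid_def
proof (intro allI)
  fix u k
  let ?y = "reweight q e c y u k"
  show "?y = 0 \<or> 1 \<le> ?y \<and> 1 - \<kappa> * charge e y A u k \<le> 1 / ?y"
  proof (cases "u \<in> e \<and> ?y \<noteq> 0")
    case True
    obtain a b where ab: "e = {a, b}" "a \<noteq> b" using edgeE[OF assms(2)] by blast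
    with True obtain w where e: "e = {u, w}" "u \<noteq> w" by (metis doubleton_eq_iff insertE singletonD)
    \<comment> \<open>A probability of 1 is excluded because division by 0 would make the new weight
      0.\<close>
    from True have k: "k \<noteq> c" "pmf q k \<noteq> 1" "y u k \<noteq> 0" and yk: "?y = y u k / (1 - pmf q k)"
      by (auto simp: reweight_def split: if_splits)
    from k have p: "pmf q k < 1" using pmf_le_1[of q k] by linarith
    from k assms(1) have y: "1 \<le> y u k" "1 - \<kappa> * A u k \<le> 1 / y u k"
      unfolding valid_def by blast+
    have "y u k * 1 \<le> y u k / (1 - pmf q k)"
      using p y(1) by (simp add: field_simps)
    moreover have "pmf q k / y u k \<le> \<kappa> * y w k"
      using assms(3)[of k] y(1) e by (simp add: weight_def pos_divide_le_eq mult_ac)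
    then have "1 - \<kappa> * charge e y A u k \<le> 1 / ?y"
      using y(2) e p unfolding yk charge_def by (simp add: diff_divide_distrib distrib_left insert_Diff_if)
    ultimately show ?thesis using y(1) yk by simp
  next
    case False
    then show ?thesis using assms(1) by (auto simp: valid_def charge_def reweight_def)
  qed
qed

section \<open>One-step estimates for loads and masses\<close>

lemma B_ge_1: "1 \<le> B" using eps by (simp add: B_def)

lemma \<alpha>_pos: "0 < \<alpha>" and \<mu>_pos: "0 < \<mu>"
  using eps B_pos by (simp_all add: \<alpha>_def \<mu>_def)

lemma \<alpha>_B_le: "\<alpha> * (2 * B) \<le> 1"
proof -
  have "B ^ 1 \<le> B ^ 4" using B_ge_1 by (intro power_increasing) auto
  then have "\<epsilon> * (2 * B) \<le> 1 * (128 * B ^ 4)"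
    using eps B_pos by (intro order_trans[OF mult_mono[of \<epsilon> 1 "2 * B" "2 * B"]]) auto
  then show ?thesis using B_pos by (simp add: \<alpha>_def pos_divide_le_eq)
qed

lemma \<mu>_B_le: "3 * (\<mu> * B\<^sup>2) \<le> 1"
proof -
  have "B ^ 2 \<le> B ^ 4" using B_ge_1 by (intro power_increasing) auto
  moreover have "0 \<le> B ^ 4" using B_pos by simp
  ultimately have "B\<^sup>2 \<le> 96 * B ^ 4" by linarith
  then have "\<epsilon> * (3 * B\<^sup>2) \<le> 1 * (288 * B ^ 4)"
    using eps B_pos by (intro order_trans[OF mult_mono[of \<epsilon> 1 "3 * B\<^sup>2" "3 * B\<^sup>2"]]) auto
  then show ?thesis using B_pos by (simp add: \<mu>_def pos_divide_le_eq mult_ac)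
qed

lemma weight_le:
  assumes "valid y A" "e \<in> E" "k < N" "\<And>v k. v \<in> V \<Longrightarrow> k < N \<Longrightarrow> y v k \<le> B"
  shows "weight y e k \<le> B\<^sup>2"
proof -
  obtain u v where e: "e = {u, v}" "u \<noteq> v" "u \<in> V" "v \<in> V" using edgeE[OF assms(2)] by metis
  have "y u k * y v k \<le> B * B"
    using e assms(3,4) valid_nonneg[OF assms(1)] B_pos by (intro mult_mono) auto
  then show ?thesis using e by (simp add: weight_def power2_eq_square)
qed

text \<open>If u lies on e, the other end moves from the sum over pending neighbors into A with its
  old weight, so the load is constant. If e misses the pending neighbors, nothing changes either.
  Otherwise the load moves by a multiple D of one jump, and the exponential moment bound
  applies.\<close>

lemma load_term_step:
  assumes y: "valid y A" "\<And>v k. v \<in> V \<Longrightarrow> k < N \<Longrightarrow> y v k \<le> B"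
    and S: "S \<subseteq> E" "e \<in> E" "e \<notin> S" and k: "k < N"
    and q: "set_pmf q \<subseteq> {..<N}" "\<And>k. pmf q k \<le> \<kappa> * weight y e k"
  shows "measure_pmf.expectation q (\<lambda>c. load_term (reweight q e c y) (charge e y A) S u k)
      \<le> load_term y A (insert e S) u k"
proof -
  have fin: "finite (set_pmf q)" using q(1) finite_subset by blast
  have "pmf q k \<le> \<kappa> * B\<^sup>2"
    using q(2)[of k] mult_left_mono[OF weight_le[OF y(1) S(2) k y(2)] less_imp_le[OF kappa_pos]]
    by linarith
  then have p_half: "pmf q k \<le> 1/2" and p_le: "pmf q k \<le> 2 / real N * B\<^sup>2"
    using kappa_B_le mult_right_mono[OF kappa_le, of "B\<^sup>2"] by auto
  then have p1: "pmf q k < 1" by simp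
  let ?T = "\<lambda>S. {g \<in> S. g \<inter> nbrs E u \<noteq> {}}"
  have finS: "finite (insert e S)" using S finite_E by (simp add: finite_subset)
  have T_mono: "card (?T S) \<le> card (?T (insert e S))"
    using finS by (intro card_mono) auto
  have const: ?thesis
    if "\<And>c. load (reweight q e c y) (charge e y A) S u k = load y A (insert e S) u k"
  proof -
    have "load_term (reweight q e c y) (charge e y A) S u k \<le> load_term y A (insert e S) u k" for c
      unfolding load_term_def that using T_mono N_pos
      by (auto intro!: mult_left_mono divide_right_mono)
    then have "measure_pmf.expectation q (\<lambda>c. load_term (reweight q e c y) (charge e y A) S u k)
      \<le> measure_pmf.expectation q (\<lambda>c. load_term y A (insert e S) u k)"
      by (intro integral_mono integrable_measure_pmf_finite[OF fin])
    then show ?thesis by simp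
  qed
  show ?thesis
  proof (cases "u \<in> e")
    case True
    obtain a b where "e = {a, b}" "a \<noteq> b" using edgeE[OF S(2)] by metis
    with True obtain w where e: "e = {u, w}" "u \<noteq> w" by (metis doubleton_eq_iff insertE singletonD)
    have w: "w \<notin> nbrs S u" using S(3) e by (simp add: nbrs_def)
    have "nbrs (insert e S) u = insert w (nbrs S u)"
      using e by (auto simp: nbrs_def doubleton_eq_iff)
    moreover have "v \<notin> e" if "v \<in> nbrs S u" for v
      using nbrs_neq[OF S(1) that] w that e by auto
    then have "(\<Sum>v\<in>nbrs S u. reweight q e c y v k) = (\<Sum>v\<in>nbrs S u. y v k)" for c
      by (intro sum.cong) (auto simp: reweight_def)
    moreover have "e - {u} = {w}" using e by auto
    ultimately show ?thesis using finite_nbrs[OF S(1)] w e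
      by (intro const) (simp add: load_def charge_def)
  next
    case False
    have nb: "nbrs (insert e S) u = nbrs S u" using False by (auto simp: nbrs_def)
    define D where "D = (\<Sum>v\<in>nbrs S u. if v \<in> e then y v k else 0)"
    have load: "load (reweight q e c y) (charge e y A) S u k = load y A (insert e S) u k + D * jump q k c" for c
    proof -
      have "(\<Sum>v\<in>nbrs S u. reweight q e c y v k)
          = (\<Sum>v\<in>nbrs S u. y v k + (if v \<in> e then y v k else 0) * jump q k c)"
        by (intro sum.cong) (auto simp: reweight_eq_jump[OF p1] algebra_simps)
      also have "\<dots> = (\<Sum>v\<in>nbrs S u. y v k) + D * jump q k c"
        by (simp add: sum.distrib D_def sum_distrib_right)
      finally show ?thesis using False by (simp add: load_def charge_def nb)
    qed
    show ?thesis
    proof (cases "nbrs S u \<inter> e = {}")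
      case True
      then have "D = 0" unfolding D_def by (intro sum.neutral) auto
      then show ?thesis using load by (intro const) simp
    next
      case nonempty: False
      have D_eq: "D = (\<Sum>v\<in>nbrs S u \<inter> e. y v k)"
        unfolding D_def using finite_nbrs[OF S(1)] by (simp add: sum.inter_restrict)
      have D0: "0 \<le> D" unfolding D_eq using valid_nonneg[OF y(1)] by (simp add: sum_nonneg)
      have fe: "finite e" "card e = 2" using edge_card[OF S(2)] card_ge_0_finite[of e] by auto
      \<comment> \<open>Both ends of e may be neighbors of u, hence the factor 2.\<close>
      have "D \<le> of_nat (card (nbrs S u \<inter> e)) * B"
        unfolding D_eq using y(2) k nbrs_subset[OF S(1)] by (intro sum_bounded_above) auto
      also have "\<dots> \<le> 2 * B"
        using fe B_pos card_mono[of e "nbrs S u \<inter> e"] by (intro mult_right_mono) auto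
      finally have D2: "D \<le> 2 * B" .
      \<comment> \<open>The count refers to all neighbors in E, so e is counted before its arrival
        and not afterwards. The freed factor \<open>exp ?b\<close> pays for the variance.\<close>
      have "nbrs S u \<subseteq> nbrs E u" using S(1) by (auto simp: nbrs_def)
      then have "?T (insert e S) = insert e (?T S)" using nonempty by auto
      then have T_card: "card (?T (insert e S)) = Suc (card (?T S))"
        using S(3) finS by simp
      let ?b = "16 * \<alpha>\<^sup>2 * B ^ 4 / real N"
      let ?M = "exp (\<alpha> * (load y A (insert e S) u k - (1 + \<epsilon> / 4) * real \<Delta>) + ?b * real (card (?T S)))"
      have "measure_pmf.expectation q (\<lambda>c. load_term (reweight q e c y) (charge e y A) S u k)
          = measure_pmf.expectation q (\<lambda>c. ?M * exp (\<alpha> * D * jump q k c))"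
        unfolding load_term_def load exp_add[symmetric] by (simp add: algebra_simps)
      also have "\<dots> = ?M * measure_pmf.expectation q (\<lambda>c. exp (\<alpha> * D * jump q k c))"
        by simp
      also have "\<dots> \<le> ?M * exp (2 * (\<alpha> * D)\<^sup>2 * pmf q k)"
      proof (intro mult_left_mono expectation_exp_jump_le[OF fin p_half])
        have "\<alpha> * D \<le> \<alpha> * (2 * B)" using \<alpha>_pos D2 by (intro mult_left_mono) auto
        also note \<alpha>_B_le
        finally show "\<bar>\<alpha> * D\<bar> \<le> 1" using \<alpha>_pos D0 by (simp add: abs_mult)
      qed simp
      also have "\<dots> \<le> ?M * exp ?b"
      proof -
        have "2 * (\<alpha> * D)\<^sup>2 * pmf q k \<le> 2 * (\<alpha> * (2 * B))\<^sup>2 * (2 / real N * B\<^sup>2)"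
          using p_le D0 D2 \<alpha>_pos by (intro mult_mono power_mono) auto
        also have "\<dots> = ?b" by (simp add: power2_eq_square power4_eq_xxxx)
        finally show ?thesis by (intro mult_left_mono) auto
      qed
      also have "\<dots> = load_term y A (insert e S) u k"
      proof -
        have "x + b * real n + b = x + b * real (Suc n)" for x b :: real and n
          by (simp add: algebra_simps)
        then show ?thesis unfolding load_term_def T_card exp_add[symmetric] by (simp only:)
      qed
      finally show ?thesis .
    qed
  qed
qed

text \<open>Distinct edges share at most one node, so only one factor of each product changes and
  the mass of f is affine in the jumps. The negative sign of \<mu> reflects that the danger is a
  falling mass.\<close>

lemma mass_term_step:
  assumes y: "valid y A" "\<And>v k. v \<in> V \<Longrightarrow> k < N \<Longrightarrow> y v k \<le> B"
    and S: "S \<subseteq> E" "e \<in> E" "e \<notin> S" "f \<in> S"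
    and q: "set_pmf q \<subseteq> {..<N}" "\<And>k. pmf q k \<le> \<kappa> * weight y e k"
  shows "measure_pmf.expectation q (\<lambda>c. mass_term (reweight q e c y) S f) \<le> mass_term y (insert e S) f"
proof -
  have fin: "finite (set_pmf q)" using q(1) finite_subset by blast
  have p_half: "pmf q k \<le> 1/2" if "k < N" for k
    using q(2)[of k] mult_left_mono[OF weight_le[OF y(1) S(2) that y(2)] less_imp_le[OF kappa_pos]]
      kappa_B_le by linarith
  let ?T = "\<lambda>S. {g \<in> S. g \<inter> f \<noteq> {}}"
  have finS: "finite (insert e S)" using S finite_E by (simp add: finite_subset)
  have T_mono: "card (?T S) \<le> card (?T (insert e S))"
    using finS by (intro card_mono) auto
  show ?thesis
  proof (cases "f \<inter> e = {}")
    case True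
    have "weight (reweight q e c y) f k = weight y f k" for c k
      unfolding weight_def using True by (intro prod.cong) (auto simp: reweight_def)
    then have "mass_term (reweight q e c y) S f \<le> mass_term y (insert e S) f" for c
      unfolding mass_term_def mass_def using T_mono by (auto intro!: mult_left_mono)
    then have "measure_pmf.expectation q (\<lambda>c. mass_term (reweight q e c y) S f)
        \<le> measure_pmf.expectation q (\<lambda>c. mass_term y (insert e S) f)"
      by (intro integral_mono integrable_measure_pmf_finite[OF fin])
    then show ?thesis by simp
  next
    case False
    have fE: "f \<in> E" using S by auto
    obtain a b where ab: "f = {a, b}" "a \<noteq> b" using edgeE[OF fE] by metis
    with False obtain u v where f: "f = {u, v}" "u \<noteq> v" "u \<in> e"
      by (metis Int_emptyI doubleton_eq_iff insertE singletonD)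
    have "v \<notin> e"
    proof
      assume "v \<in> e"
      with f have "f \<subseteq> e" by auto
      moreover have "finite e" "card e = 2" "card f = 2"
        using edge_card[OF S(2)] edge_card[OF fE] card_ge_0_finite[of e] by auto
      ultimately have "f = e" by (metis card_subset_eq)
      with S show False by auto
    qed
    then have "weight (reweight q e c y) f k = weight y f k + weight y f k * jump q k c" if "k < N" for c k
      using f p_half[OF that] by (simp add: weight_def reweight_eq_jump algebra_simps)
    then have mass: "mass (reweight q e c y) f = mass y f + (\<Sum>k<N. weight y f k * jump q k c)" for c
      by (simp add: mass_def sum.distrib)
    have "?T (insert e S) = insert e (?T S)" using False by auto
    then have T_card: "card (?T (insert e S)) = Suc (card (?T S))"
      using S(3) finS by simp
    let ?b = "9 * \<mu>\<^sup>2 * B ^ 4"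
    let ?M = "exp (\<mu> * ((1 - \<epsilon> / 8) * real N - mass y f) + ?b * real (card (?T S)))"
    have "measure_pmf.expectation q (\<lambda>c. mass_term (reweight q e c y) S f)
        = measure_pmf.expectation q (\<lambda>c. ?M * exp (\<Sum>k<N. - \<mu> * weight y f k * jump q k c))"
      unfolding mass_term_def mass exp_add[symmetric]
      by (simp add: algebra_simps sum_negf sum_distrib_left)
    also have "\<dots> = ?M * measure_pmf.expectation q (\<lambda>c. exp (\<Sum>k<N. - \<mu> * weight y f k * jump q k c))"
      by simp
    also have "\<dots> \<le> ?M * exp (9 * (\<mu> * B\<^sup>2)\<^sup>2)"
    proof (intro mult_left_mono expectation_exp_jump_sum_le[OF q(1) p_half])
      fix k assume "k < N"
      then show "\<bar>- \<mu> * weight y f k\<bar> \<le> \<mu> * B\<^sup>2"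
        using weight_le[OF y(1) fE _ y(2), of k] weight_nonneg[OF y(1)] \<mu>_pos
        by (simp add: abs_mult)
    qed (use \<mu>_B_le in auto)
    also have "\<dots> = mass_term y (insert e S) f"
      unfolding mass_term_def T_card exp_add[symmetric]
      by (simp add: algebra_simps power2_eq_square power4_eq_xxxx)
    finally show ?thesis .
  qed
qed

section \<open>The potential bounds the failure probability\<close>

lemma load_term_nonneg: "0 \<le> load_term y A S u k" and mass_term_nonneg: "0 \<le> mass_term y S f"
  by (simp_all add: load_term_def mass_term_def)

text \<open>By linearity the one-step bounds are added up; the mass term of e itself leaves the sum
  and is nonnegative.\<close>

lemma potential_step:
  assumes y: "valid y A" "\<And>v k. v \<in> V \<Longrightarrow> k < N \<Longrightarrow> y v k \<le> B"
    and S: "S \<subseteq> E" "e \<in> E" "e \<notin> S"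
    and q: "set_pmf q \<subseteq> {..<N}" "\<And>k. pmf q k \<le> \<kappa> * weight y e k"
  shows "measure_pmf.expectation q (\<lambda>c. potential (reweight q e c y) (charge e y A) S)
      \<le> potential y A (insert e S)"
proof -
  have fin: "finite (set_pmf q)" using q(1) finite_subset by blast
  note [simp] = integrable_measure_pmf_finite[OF fin]
  have finS: "finite S" using S finite_E by (simp add: finite_subset)
  have "measure_pmf.expectation q (\<lambda>c. potential (reweight q e c y) (charge e y A) S)
     = (\<Sum>u\<in>V. \<Sum>k<N. measure_pmf.expectation q (\<lambda>c. load_term (reweight q e c y) (charge e y A) S u k))
      + (\<Sum>f\<in>S. measure_pmf.expectation q (\<lambda>c. mass_term (reweight q e c y) S f))"
    by (simp add: potential_def)
  also have "\<dots> \<le> (\<Sum>u\<in>V. \<Sum>k<N. load_term y A (insert e S) u k) + (\<Sum>f\<in>S. mass_term y (insert e S) f)"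
    by (intro add_mono sum_mono load_term_step[OF y S _ q] mass_term_step[OF y S _ q]) auto
  also have "\<dots> \<le> potential y A (insert e S)"
    unfolding potential_def using S(3) finS mass_term_nonneg by simp
  finally show ?thesis .
qed

lemma potential_nonneg: "0 \<le> potential y A S"
  unfolding potential_def
  by (intro add_nonneg_nonneg sum_nonneg load_term_nonneg mass_term_nonneg)

lemma potential_small:
  assumes "finite S" "potential y A S < 1"
  shows "u \<in> V \<Longrightarrow> k < N \<Longrightarrow> load y A S u k < (1 + \<epsilon> / 4) * real \<Delta>"
    and "f \<in> S \<Longrightarrow> (1 - \<epsilon> / 8) * real N < mass y f"
proof -
  assume uk: "u \<in> V" "k < N"
  have "load_term y A S u k \<le> (\<Sum>k<N. load_term y A S u k)"
    using uk by (intro member_le_sum) (auto simp: load_term_nonneg)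
  also have "\<dots> \<le> (\<Sum>u\<in>V. \<Sum>k<N. load_term y A S u k)"
    using uk finite_V by (intro member_le_sum[of u V "\<lambda>u. \<Sum>k<N. load_term y A S u k"])
      (auto simp: load_term_nonneg sum_nonneg)
  also have "\<dots> \<le> potential y A S"
    unfolding potential_def by (simp add: mass_term_nonneg sum_nonneg)
  finally have "load_term y A S u k < exp 0" using assms(2) by simp
  then have "\<alpha> * (load y A S u k - (1 + \<epsilon> / 4) * real \<Delta>)
      + 16 * \<alpha>\<^sup>2 * B ^ 4 / real N * real (card {g \<in> S. g \<inter> nbrs E u \<noteq> {}}) < 0"
    unfolding load_term_def exp_less_cancel_iff .
  moreover have "0 \<le> 16 * \<alpha>\<^sup>2 * B ^ 4 / real N * real (card {g \<in> S. g \<inter> nbrs E u \<noteq> {}})"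
    by simp
  ultimately have "\<alpha> * (load y A S u k - (1 + \<epsilon> / 4) * real \<Delta>) < 0" by linarith
  then show "load y A S u k < (1 + \<epsilon> / 4) * real \<Delta>"
    using \<alpha>_pos by (simp add: mult_less_0_iff)
next
  assume f: "f \<in> S"
  have "mass_term y S f \<le> (\<Sum>f\<in>S. mass_term y S f)"
    using f assms(1) by (intro member_le_sum) (auto simp: mass_term_nonneg)
  also have "\<dots> \<le> potential y A S"
    unfolding potential_def by (simp add: load_term_nonneg sum_nonneg)
  finally have "mass_term y S f < exp 0" using assms(2) by simp
  then have "\<mu> * ((1 - \<epsilon> / 8) * real N - mass y f)
     + 9 * \<mu>\<^sup>2 * B ^ 4 * real (card {g \<in> S. g \<inter> f \<noteq> {}}) < 0"
    unfolding mass_term_def exp_less_cancel_iff .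
  moreover have "0 \<le> 9 * \<mu>\<^sup>2 * B ^ 4 * real (card {g \<in> S. g \<inter> f \<noteq> {}})" by simp
  ultimately have "\<mu> * ((1 - \<epsilon> / 8) * real N - mass y f) < 0" by linarith
  then show "(1 - \<epsilon> / 8) * real N < mass y f"
    using \<mu>_pos by (simp add: mult_less_0_iff)
qed

abbreviation seed_pmf :: "nat pmf" where
  "seed_pmf \<equiv> pmf_of_set {..<L}"

lemma finite_seeds: "finite (set_pmf (replicate_pmf m seed_pmf))"
  using L_pos by (intro finite_set_replicate_pmf) (simp add: set_pmf_of_set lessThan_empty_iff)

text \<open>A potential of at least 1 makes the claim trivial. Below 1, all weights are at most B
  and the next edge is feasible, so the supermartingale step applies to the first seed and the
  induction hypothesis to the rest.\<close>

lemma failure_prob_le_potential: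
  assumes "valid y A" "set es \<subseteq> E" "distinct es" "length es \<le> m"
  shows "measure_pmf.prob (replicate_pmf m seed_pmf) {ss. \<not> succeeds y es ss} \<le> potential y A (set es)"
  using assms
proof (induction es arbitrary: y A m)
  case Nil
  then show ?case using potential_nonneg by simp
next
  case (Cons e es)
  show ?case
  proof (cases "potential y A (set (e # es)) < 1")
    case False
    then show ?thesis
      using measure_pmf.prob_le_1 by (meson linorder_not_less order_trans)
  next
    case True
    obtain m' where m: "m = Suc m'" "length es \<le> m'" using Cons.prems(4) by (cases m) auto
    have yB: "y v k \<le> B" if "v \<in> V" "k < N" for v k
      using state_le_B[OF Cons.prems(1,2) potential_small(1)[OF _ True that]] by simp
    have "feasible y e"
      using feasible_if_mass[OF Cons.prems(1) potential_small(2)[OF _ True]] by simp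
    note feas = this
    have q: "pmf (color_pmf y e) k \<le> \<kappa> * weight y e k" for k
      using kappa_pos weight_nonneg[OF Cons.prems(1)] by (intro pmf_color_pmf_le[OF feas]) simp
    note q = set_color_pmf[OF feas] q
    have eE: "e \<in> E" and esE: "set es \<subseteq> E" and e: "e \<notin> set es" using Cons.prems by auto
    have L_ne: "{..<L} \<noteq> {}" using L_pos by (simp add: lessThan_empty_iff)
    note [simp] = integrable_measure_pmf_finite[OF finite_seeds]
    have "measure_pmf.prob (replicate_pmf m seed_pmf) {ss. \<not> succeeds y (e # es) ss}
       = measure_pmf.expectation seed_pmf (\<lambda>s. measure_pmf.prob (replicate_pmf m' seed_pmf)
           {ss. \<not> succeeds (step y (e, s)) es ss})"
    proof -
      have "replicate_pmf m seed_pmf = seed_pmf \<bind> (\<lambda>s. map_pmf ((#) s) (replicate_pmf m' seed_pmf))"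
        by (simp add: m map_pmf_def)
      then show ?thesis
        using finite_seeds L_ne feas
        by (simp add: prob_bind_pmf_of_set vimage_def)
    qed
    also have "\<dots> \<le> measure_pmf.expectation seed_pmf (\<lambda>s. potential (step y (e, s)) (charge e y A) (set es))"
    proof (intro integral_mono integrable_measure_pmf_finite)
      fix s
      have "valid (step y (e, s)) (charge e y A)"
        using valid_step[OF Cons.prems(1) eE q(2)] feas by (simp add: step_def)
      from Cons.IH[OF this esE _ m(2)] Cons.prems(3)
      show "measure_pmf.prob (replicate_pmf m' seed_pmf) {ss. \<not> succeeds (step y (e, s)) es ss}
          \<le> potential (step y (e, s)) (charge e y A) (set es)" by simp
    qed (use L_ne in \<open>simp_all add: set_pmf_of_set\<close>)
    also have "\<dots> = measure_pmf.expectation (color_pmf y e)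
        (\<lambda>c. potential (reweight (color_pmf y e) e c y) (charge e y A) (set es))"
    proof -
      have "measure_pmf.expectation (color_pmf y e) F = measure_pmf.expectation seed_pmf (\<lambda>s. F (pick y e s))"
        for F :: "nat \<Rightarrow> real" by (simp add: color_pmf_def)
      then show ?thesis using feas by (simp add: step_def)
    qed
    also have "\<dots> \<le> potential y A (insert e (set es))"
      by (rule potential_step[OF Cons.prems(1) yB esE eE e q])
    finally show ?thesis by simp
  qed
qed

section \<open>Size of the initial potential\<close>

lemma card_incident_le:
  assumes "X \<subseteq> V"
  shows "card {g \<in> E. g \<inter> X \<noteq> {}} \<le> card X * \<Delta>"
proof -
  have finX: "finite X" using assms finite_V finite_subset by metis
  have "{g \<in> E. g \<inter> X \<noteq> {}} = (\<Union>v\<in>X. {g \<in> E. v \<in> g})" by auto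
  then have "card {g \<in> E. g \<inter> X \<noteq> {}} \<le> (\<Sum>v\<in>X. card {g \<in> E. v \<in> g})"
    using card_UN_le[OF finX] by metis
  also have "\<dots> \<le> of_nat (card X) * \<Delta>"
    using degree_le assms unfolding vertex_degree_def by (intro sum_bounded_above) auto
  finally show ?thesis by simp
qed

lemma card_nbrs_le:
  assumes "u \<in> V"
  shows "card (nbrs E u) \<le> \<Delta>"
proof -
  have "card (nbrs E u) = card ((\<lambda>v. {u, v}) ` nbrs E u)"
    by (rule card_image[symmetric]) (auto simp: inj_on_def doubleton_eq_iff)
  also have "\<dots> \<le> card {e \<in> E. u \<in> e}"
    using finite_E by (intro card_mono) (auto simp: nbrs_def)
  also have "\<dots> \<le> \<Delta>" using degree_le[OF assms] by (simp add: vertex_degree_def)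
  finally show ?thesis .
qed

lemma \<Delta>_le_N: "real \<Delta> \<le> real N"
proof -
  have "1 * real \<Delta> \<le> (1 + \<epsilon>) * real \<Delta>" using eps by (intro mult_right_mono) auto
  then show ?thesis using N_ge by simp
qed

text \<open>At most \<Delta>^2, hence \<Delta> * N, edges meet the neighborhood of a node, and at
  most 2 * \<Delta> edges meet an edge. With these counts half of each initial margin
  survives.\<close>

lemma initial_potential_le:
  "potential (\<lambda>_ _. 1) (\<lambda>_ _. 0) E
    \<le> (real (card V) * real N + real (card E)) * exp (- (\<epsilon> ^ 6 * real \<Delta> / 2 ^ 21))"
proof -
  let ?x = "\<epsilon> ^ 6 * real \<Delta> / 2 ^ 21"
  have load: "load_term (\<lambda>_ _. 1) (\<lambda>_ _. 0) E u k \<le> exp (- ?x)" if u: "u \<in> V" for u k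
  proof -
    let ?n = "real (card {g \<in> E. g \<inter> nbrs E u \<noteq> {}})"
    have "card {g \<in> E. g \<inter> nbrs E u \<noteq> {}} \<le> card (nbrs E u) * \<Delta>"
      by (rule card_incident_le) (simp add: nbrs_subset)
    also have "\<dots> \<le> \<Delta> * \<Delta>" using card_nbrs_le[OF u] by simp
    finally have n: "?n \<le> real \<Delta> * real \<Delta>" by (metis of_nat_mono of_nat_mult)
    also have "\<dots> \<le> real \<Delta> * real N" using \<Delta>_le_N by (intro mult_left_mono) auto
    finally have "?n / real N \<le> real \<Delta>" using N_pos by (simp add: pos_divide_le_eq)
    then have "16 * \<alpha>\<^sup>2 * B ^ 4 * (?n / real N) \<le> 16 * \<alpha>\<^sup>2 * B ^ 4 * real \<Delta>"
      by (intro mult_left_mono) auto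
    also have "\<dots> = \<alpha> * \<epsilon> / 8 * real \<Delta>"
    proof -
      have "\<alpha> * B ^ 4 = \<epsilon> / 128" using B_pos by (simp add: \<alpha>_def)
      then have "16 * \<alpha>\<^sup>2 * B ^ 4 = 16 * \<alpha> * (\<epsilon> / 128)" unfolding power2_eq_square by (simp only: mult.assoc)
      then show ?thesis by simp
    qed
    finally have 1: "16 * \<alpha>\<^sup>2 * B ^ 4 * (?n / real N) \<le> \<alpha> * \<epsilon> / 8 * real \<Delta>" .
    have "load (\<lambda>_ _. 1) (\<lambda>_ _. 0) E u k \<le> real \<Delta>"
      using card_nbrs_le[OF u] by (simp add: load_def)
    then have "\<alpha> * (load (\<lambda>_ _. 1) (\<lambda>_ _. 0) E u k - (1 + \<epsilon> / 4) * real \<Delta>) \<le> \<alpha> * (- \<epsilon> / 4 * real \<Delta>)"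
      using \<alpha>_pos by (intro mult_left_mono) (auto simp: algebra_simps)
    also have "\<dots> = - 2 * (\<alpha> * \<epsilon> / 8 * real \<Delta>)" by simp
    finally have "\<alpha> * (load (\<lambda>_ _. 1) (\<lambda>_ _. 0) E u k - (1 + \<epsilon> / 4) * real \<Delta>)
        + 16 * \<alpha>\<^sup>2 * B ^ 4 * (?n / real N) \<le> - (\<alpha> * \<epsilon> / 8 * real \<Delta>)"
      using 1 by linarith
    moreover have "16 * \<alpha>\<^sup>2 * B ^ 4 / real N * ?n = 16 * \<alpha>\<^sup>2 * B ^ 4 * (?n / real N)" by simp
    ultimately have "\<alpha> * (load (\<lambda>_ _. 1) (\<lambda>_ _. 0) E u k - (1 + \<epsilon> / 4) * real \<Delta>)
        + 16 * \<alpha>\<^sup>2 * B ^ 4 / real N * ?n \<le> - (\<alpha> * \<epsilon> / 8 * real \<Delta>)" by (simp only:)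
    \<comment> \<open>Here B = 4 / \<epsilon> contributes four powers of \<epsilon>, \<alpha> a
      fifth and the margin the sixth. The denominator 2^21 is a common bound for this and the mass
      exponent.\<close>
    also have "\<alpha> * \<epsilon> / 8 = \<epsilon> ^ 6 / 2 ^ 18"
      using eps by (simp add: \<alpha>_def B_def field_simps power2_eq_square power_def)
    also have "- (\<epsilon> ^ 6 / 2 ^ 18 * real \<Delta>) \<le> - ?x"
      using eps by (simp add: field_simps)
    finally show ?thesis by (simp add: load_term_def)
  qed
  have mass: "mass_term (\<lambda>_ _. 1) E f \<le> exp (- ?x)" if f: "f \<in> E" for f
  proof -
    let ?n = "real (card {g \<in> E. g \<inter> f \<noteq> {}})"
    have "card {g \<in> E. g \<inter> f \<noteq> {}} \<le> 2 * \<Delta>"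
      using card_incident_le[OF edge_subset[OF f]] edge_card[OF f] by simp
    then have "?n \<le> 2 * real N" using \<Delta>_le_N by linarith
    then have "9 * \<mu>\<^sup>2 * B ^ 4 * ?n \<le> 9 * \<mu>\<^sup>2 * B ^ 4 * (2 * real N)"
      by (intro mult_left_mono) auto
    also have "\<dots> = \<mu> * \<epsilon> / 16 * real N"
    proof -
      have "\<mu> * B ^ 4 = \<epsilon> / 288" using B_pos by (simp add: \<mu>_def)
      then have "9 * \<mu>\<^sup>2 * B ^ 4 = 9 * \<mu> * (\<epsilon> / 288)" unfolding power2_eq_square by (simp only: mult.assoc)
      then show ?thesis by simp
    qed
    finally have 1: "9 * \<mu>\<^sup>2 * B ^ 4 * ?n \<le> \<mu> * \<epsilon> / 16 * real N" .
    have "mass (\<lambda>_ _. 1) f = real N" by (simp add: mass_def weight_def)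
    then have "\<mu> * ((1 - \<epsilon> / 8) * real N - mass (\<lambda>_ _. 1) f) = - 2 * (\<mu> * \<epsilon> / 16 * real N)"
      by (simp add: algebra_simps)
    with 1 have "\<mu> * ((1 - \<epsilon> / 8) * real N - mass (\<lambda>_ _. 1) f) + 9 * \<mu>\<^sup>2 * B ^ 4 * ?n
        \<le> - (\<mu> * \<epsilon> / 16 * real N)"
      by linarith
    also have "\<dots> \<le> - (\<mu> * \<epsilon> / 16 * real \<Delta>)"
      using \<mu>_pos eps \<Delta>_le_N by (simp add: mult_left_mono)
    also have "\<mu> * \<epsilon> / 16 = \<epsilon> ^ 6 / 1179648"
      using eps by (simp add: \<mu>_def B_def field_simps power2_eq_square power_def)
    also have "- (\<epsilon> ^ 6 / 1179648 * real \<Delta>) \<le> - ?x"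
      using eps by (simp add: field_simps)
    finally show ?thesis by (simp add: mass_term_def)
  qed
  have "(\<Sum>u\<in>V. \<Sum>k<N. load_term (\<lambda>_ _. 1) (\<lambda>_ _. 0) E u k) \<le> (\<Sum>u\<in>V. \<Sum>k<N. exp (- ?x))"
    by (intro sum_mono load)
  moreover have "(\<Sum>f\<in>E. mass_term (\<lambda>_ _. 1) E f) \<le> (\<Sum>f\<in>E. exp (- ?x))"
    by (intro sum_mono mass)
  ultimately show ?thesis by (simp add: potential_def algebra_simps)
qed

lemma failure_prob_le:
  assumes "es \<in> permutations_of_set E" "card E \<le> m"
  shows "measure_pmf.prob (replicate_pmf m seed_pmf) {ss. \<not> succeeds (\<lambda>_ _. 1) es ss}
    \<le> (real (card V) * real N + real (card E)) * exp (- (\<epsilon> ^ 6 * real \<Delta> / 2 ^ 21))"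
proof -
  have es: "set es = E" "distinct es" using assms(1) by (auto simp: permutations_of_set_def)
  then have "length es \<le> m" using assms(2) distinct_card by metis
  moreover have "valid (\<lambda>_ _. 1) (\<lambda>_ _. 0)" by (simp add: valid_def)
  ultimately have "measure_pmf.prob (replicate_pmf m seed_pmf) {ss. \<not> succeeds (\<lambda>_ _. 1) es ss}
      \<le> potential (\<lambda>_ _. 1) (\<lambda>_ _. 0) (set es)"
    using es by (intro failure_prob_le_potential) auto
  then show ?thesis using initial_potential_le es(1) by simp
qed

end

section \<open>Choice of parameters\<close>

text \<open>Solves \<epsilon>^6 * d = 2^24 * ln n, so that the exponent \<epsilon>^6 * d / 2^21
  equals 8 * ln n.\<close>

definition slack :: "nat \<Rightarrow> nat \<Rightarrow> real" where
  "slack n d = 16 * (ln (real n) / real d) powr (1/6)"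

definition palette_size :: "nat \<Rightarrow> nat \<Rightarrow> nat" where
  "palette_size n d = nat \<lceil>(1 + slack n d) * real d\<rceil>"

text \<open>\<open>Suc\<close> provides a seed value even for degenerate arguments, where the slack
  may be 0.\<close>

definition resolution :: "nat \<Rightarrow> nat \<Rightarrow> nat" where
  "resolution n d = Suc (nat \<lceil>16 * real (palette_size n d) / slack n d\<rceil>)"

definition rate :: "nat \<Rightarrow> nat \<Rightarrow> real" where
  "rate n d = (1 + slack n d / 4) / real (palette_size n d)"

text \<open>The number of edges is unknown in advance, so n * n seeds are drawn as an upper
  bound.\<close>

definition palette_algorithm :: online_algorithm where
  "palette_algorithm n d =
     map_pmf (edge_palette.palette_rule (palette_size n d) (resolution n d) (rate n d))
       (replicate_pmf (n * n) (pmf_of_set {..<resolution n d}))"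

section \<open>Guarantees for a fixed input graph\<close>

lemma edge_palette: "edge_palette (resolution n d)"
  by unfold_locales (simp add: resolution_def)

lemma card_edges_le:
  assumes "simple_graph V E"
  shows "card E \<le> card V * card V"
proof -
  have V: "finite V" using assms by (simp add: simple_graph_def)
  have "E \<subseteq> (\<lambda>(a, b). {a, b}) ` (V \<times> V)"
  proof
    fix e assume "e \<in> E"
    then have "card e = 2" "e \<subseteq> V" using assms by (simp_all add: simple_graph_def)
    then obtain u v where "e = {u, v}" by (meson card_2_iff)
    then show "e \<in> (\<lambda>(a, b). {a, b}) ` (V \<times> V)" using \<open>e \<subseteq> V\<close> by force
  qed
  then have "card E \<le> card (V \<times> V)"
    using V by (intro surj_card_le[of "V \<times> V" E]) auto
  then show ?thesis by (simp only: card_cartesian_product)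
qed

lemma set_palette_seeds:
  "set_pmf (replicate_pmf m (pmf_of_set {..<resolution n d})) = {ss. set ss \<subseteq> {..<resolution n d} \<and> length ss = m}"
proof -
  have "{..<resolution n d} \<noteq> {}" by (simp add: resolution_def lessThan_empty_iff)
  then show ?thesis by (auto simp: set_replicate_pmf set_pmf_of_set lists_eq_set)
qed

lemma palette_rule_seed_proper:
  assumes "simple_graph V E" "es \<in> permutations_of_set E" "card V = n"
    and ss: "ss \<in> set_pmf (replicate_pmf (n * n) (pmf_of_set {..<resolution n d}))"
  shows "proper_edge_coloring E
    (online_coloring (edge_palette.palette_rule (palette_size n d) (resolution n d) (rate n d) ss) es)"
proof -
  have es: "set es = E" "distinct es" using assms(2) by (auto simp: permutations_of_set_def)
  then have "length es \<le> n * n" using card_edges_le[OF assms(1)] assms(3) by (metis distinct_card)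
  moreover have "finite e" if "e \<in> E" for e
    using assms(1) that unfolding simple_graph_def by (metis finite_subset)
  ultimately show ?thesis
    using edge_palette.palette_rule_proper[OF edge_palette es(2), of ss] ss
    unfolding es(1) set_palette_seeds by simp
qed

lemma palette_algorithm_proper: "online_edge_coloring_algorithm palette_algorithm"
  unfolding online_edge_coloring_algorithm_def palette_algorithm_def set_map_pmf
  using palette_rule_seed_proper by blast

lemma vertex_degree_le_max_degree:
  assumes "finite V" "v \<in> V"
  shows "vertex_degree E v \<le> max_degree V E"
  unfolding max_degree_def using assms by (intro Max_ge) auto

lemma max_degree_le_card:
  assumes "simple_graph V E" "V \<noteq> {}"
  shows "max_degree V E \<le> card V"
proof -
  have V: "finite V" using assms by (simp add: simple_graph_def)
  have "vertex_degree E v \<le> card V" for v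
  proof -
    have "{e \<in> E. v \<in> e} \<subseteq> (\<lambda>w. {v, w}) ` V"
    proof
      fix e assume "e \<in> {e \<in> E. v \<in> e}"
      then have "card e = 2" "e \<subseteq> V" "v \<in> e" using assms by (simp_all add: simple_graph_def)
      then obtain a b where "e = {a, b}" "a \<in> V" "b \<in> V" "v = a \<or> v = b"
        by (metis card_2_iff insert_iff insert_subset singletonD)
      then show "e \<in> (\<lambda>w. {v, w}) ` V" by auto
    qed
    then show ?thesis unfolding vertex_degree_def using V by (rule surj_card_le[rotated])
  qed
  then show ?thesis unfolding max_degree_def using assms V by simp
qed

text \<open>The rule and the order are drawn independently. Drawing the order first, the failure
  probability becomes an average of bounds for fixed orders.\<close>

lemma random_order_run_prob_ge:
  assumes G: "simple_graph V E" and n: "card V = n" and d: "max_degree V E = d"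
    and bound: "\<And>es. es \<in> permutations_of_set E \<Longrightarrow>
      measure_pmf.prob (palette_algorithm n d) {f. online_coloring f es \<notin> X} \<le> p"
  shows "1 - p \<le> measure_pmf.prob (random_order_run palette_algorithm V E) X"
proof -
  let ?P = "pmf_of_set (permutations_of_set E)"
  have finE: "finite E" using G by (auto simp: simple_graph_def intro: finite_subset[of E "Pow V"])
  have P: "permutations_of_set E \<noteq> {}" "finite (permutations_of_set E)"
    using finE by simp_all
  have run: "random_order_run palette_algorithm V E
      = ?P \<bind> (\<lambda>es. map_pmf (\<lambda>f. online_coloring f es) (palette_algorithm n d))"
    unfolding random_order_run_def n d
    by (subst pair_commute_pmf)
      (simp add: pair_pmf_def map_pmf_def bind_assoc_pmf bind_return_pmf)
  have "finite (set_pmf (pmf_of_set {..<resolution n d}))"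
    by (simp add: resolution_def lessThan_empty_iff set_pmf_of_set)
  then have fin: "finite (set_pmf (palette_algorithm n d))"
    by (simp add: palette_algorithm_def finite_set_replicate_pmf)
  have "measure_pmf.prob (random_order_run palette_algorithm V E) (- X)
      = measure_pmf.expectation ?P
          (\<lambda>es. measure_pmf.prob (map_pmf (\<lambda>f. online_coloring f es) (palette_algorithm n d)) (- X))"
    unfolding run by (rule prob_bind_pmf_of_set) (use P fin in auto)
  also have "\<dots> \<le> measure_pmf.expectation ?P (\<lambda>_. p)"
    using P bound by (intro integral_mono_AE integrable_measure_pmf_finite)
      (auto simp: AE_measure_pmf_iff set_pmf_of_set vimage_def)
  also have "\<dots> = p" by simp
  finally show ?thesis
    using measure_pmf.prob_compl[of X "random_order_run palette_algorithm V E"]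
    by (simp add: Compl_eq_Diff_UNIV)
qed

text \<open>The initial potential has at most 4 * n^2 as its prefactor and n^(-8) as its
  exponential, which leaves ample room below 1 / n.\<close>

lemma palette_algorithm_prob:
  assumes G: "simple_graph V E" and n: "card V = n" and d: "max_degree V E = d"
    and large: "2 \<le> n" "1 \<le> ln (real n)" "0 < d" and slack: "slack n d \<le> 1/2"
  shows "measure_pmf.prob (random_order_run palette_algorithm V E)
      {col. proper_edge_coloring E col \<and> card (col ` E) \<le> palette_size n d}
    \<ge> 1 - 1 / real n"
proof -
  let ?N = "palette_size n d" and ?L = "resolution n d" and ?e = "slack n d"
  have ratio: "0 < ln (real n) / real d" using large by simp
  have "0 < (ln (real n) / real d) powr (1/6)" using ratio by (metis less_irrefl powr_gt_zero)
  then have e0: "0 < ?e" unfolding slack_def by simp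
  have "?e ^ 6 = 16 ^ 6 * ((ln (real n) / real d) powr (1/6)) ^ 6"
    by (simp add: slack_def power_mult_distrib)
  also have "((ln (real n) / real d) powr (1/6)) ^ 6 = ln (real n) / real d"
    using large by (subst powr_power) auto
  finally have e6: "?e ^ 6 * real d = 2 ^ 24 * ln (real n)"
    using large by simp
  \<comment> \<open>As the slack is below 1, its square times d is at least its sixth power times d,
    that is 2^24 * ln n.\<close>
  have "64 / ?e\<^sup>2 \<le> real d"
  proof -
    have "?e ^ 6 \<le> ?e\<^sup>2" using e0 slack by (intro power_decreasing) auto
    then have "?e ^ 6 * real d \<le> ?e\<^sup>2 * real d" by (intro mult_right_mono) auto
    moreover have "64 * 1 \<le> ?e ^ 6 * real d" unfolding e6 using large(2) by (intro mult_mono) auto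
    ultimately have "64 \<le> ?e\<^sup>2 * real d" by linarith
    then show ?thesis using e0 by (simp add: pos_divide_le_eq mult.commute)
  qed
  moreover have N1: "(1 + ?e) * real d \<le> real ?N"
    unfolding palette_size_def by linarith
  moreover have "1 * real d \<le> (1 + ?e) * real d" using e0 by (intro mult_right_mono) auto
  moreover have "16 * real ?N / ?e \<le> real ?L" unfolding resolution_def by linarith
  moreover have finV: "finite V" using G by (simp add: simple_graph_def)
  ultimately interpret palette_analysis ?N ?L "rate n d" V E d ?e
    using G e0 slack vertex_degree_le_max_degree[of V _ E] d
    by unfold_locales (auto simp: resolution_def rate_def)
  have d_n: "d \<le> n" using max_degree_le_card[OF G] n d large by fastforce
  have "real ?N \<le> (1 + ?e) * real d + 1"
    unfolding palette_size_def using e0 by (simp add: of_nat_nat)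
  also have "\<dots> \<le> 2 * real d + real d"
    using slack large(3) by (intro add_mono mult_right_mono) auto
  also have "\<dots> \<le> 3 * real n" using d_n by simp
  finally have N_n: "real ?N \<le> 3 * real n" .
  have E_n: "card E \<le> n * n" using card_edges_le[OF G] n by simp
  have "exp (- (?e ^ 6 * real d / 2 ^ 21)) = 1 / real n ^ 8"
  proof -
    have "?e ^ 6 * real d / 2 ^ 21 = real 8 * ln (real n)" unfolding e6 by simp
    moreover have "exp (real 8 * ln (real n)) = real n ^ 8"
      using large unfolding exp_of_nat_mult by simp
    ultimately show ?thesis by (simp add: exp_minus inverse_eq_divide)
  qed
  then have "(real (card V) * real ?N + real (card E)) * exp (- (?e ^ 6 * real d / 2 ^ 21))
      \<le> (real n * (3 * real n) + real n * real n) * (1 / real n ^ 8)"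
    unfolding n using N_n E_n by (intro mult_mono add_mono) (auto simp flip: of_nat_mult)
  also have "\<dots> = 4 / real n ^ 5 / real n"
    using large by (simp add: field_simps power_def)
  also have "\<dots> \<le> 1 / real n"
  proof -
    have "32 \<le> real n ^ 5" using power_mono[of 2 "real n" 5] large by simp
    then have "4 \<le> real n ^ 5" "0 < real n ^ 5" by linarith+
    then have "4 / real n ^ 5 \<le> 1" by (simp add: pos_divide_le_eq)
    then show ?thesis by (intro divide_right_mono) auto
  qed
  finally have small: "(real (card V) * real ?N + real (card E)) * exp (- (?e ^ 6 * real d / 2 ^ 21)) \<le> 1 / real n" .
  let ?X = "{col. proper_edge_coloring E col \<and> card (col ` E) \<le> ?N}"
  show ?thesis
  proof (rule random_order_run_prob_ge[OF G n d])
    fix es assume es: "es \<in> permutations_of_set E"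
    then have set_es: "set es = E" "distinct es" by (auto simp: permutations_of_set_def)
    then have len: "length es \<le> n * n" using E_n by (metis distinct_card)
    let ?S = "replicate_pmf (n * n) seed_pmf"
    have "measure_pmf.prob (palette_algorithm n d) {f. online_coloring f es \<notin> ?X}
        = measure_pmf.prob ?S {ss. online_coloring (palette_rule ss) es \<notin> ?X}"
      by (simp add: palette_algorithm_def vimage_def)
    \<comment> \<open>Properness holds for every seed list in the support, so only too many colors
      can put a run outside \<open>?X\<close>, and this forces an infeasible edge.\<close>
    also have "\<dots> \<le> measure_pmf.prob ?S {ss. \<not> succeeds (\<lambda>_ _. 1) es ss}"
    proof (rule measure_pmf.finite_measure_mono_AE)
      have "\<not> succeeds (\<lambda>_ _. 1) es ss"
        if ss: "ss \<in> set_pmf ?S" and "online_coloring (palette_rule ss) es \<notin> ?X" for ss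
      proof
        assume "succeeds (\<lambda>_ _. 1) es ss"
        then have "card (online_coloring (palette_rule ss) es ` E) \<le> ?N"
          using card_colors_le[of es ss] set_es len ss unfolding set_palette_seeds by auto
        with palette_rule_seed_proper[OF G es n ss] that(2) show False by simp
      qed
      then show "AE ss in ?S. ss \<in> {ss. online_coloring (palette_rule ss) es \<notin> ?X}
          \<longrightarrow> ss \<in> {ss. \<not> succeeds (\<lambda>_ _. 1) es ss}"
        unfolding AE_measure_pmf_iff by blast
    qed simp
    also have "\<dots> \<le> 1 / real n"
      by (rule order_trans[OF failure_prob_le[OF es E_n] small])
    finally show "measure_pmf.prob (palette_algorithm n d) {f. online_coloring f es \<notin> ?X} \<le> 1 / real n" .
  qed
qed

text \<open>The slack contributes 16 times \<open>?g\<close>, and the ceiling at most 1, which is at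
  most \<open>?g\<close> since both factors of \<open>?g\<close> are at least 1. The constant 32
  covers both.\<close>

lemma palette_size_le_color_bound:
  assumes "1 \<le> ln (real n)" "ln (real n) \<le> real d"
  shows "real (palette_size n d) \<le> color_bound 32 (5/6) n d"
proof -
  let ?l = "ln (real n)"
  let ?g = "real d powr (5/6) * ?l powr (1/6)"
  have d: "1 \<le> real d" using assms by linarith
  have "slack n d * real d = 16 * ?l powr (1/6) * (real d / real d powr (1/6))"
    using assms d by (simp add: slack_def powr_divide)
  also have "real d / real d powr (1/6) = real d powr (5/6)"
    using d powr_diff[of "real d" 1 "1/6"] by simp
  finally have e: "slack n d * real d = 16 * ?g" by simp
  have "1 * 1 \<le> ?g"
    using d assms by (intro mult_mono ge_one_powr_ge_zero) auto
  moreover have "real (palette_size n d) \<le> (1 + slack n d) * real d + 1"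
    unfolding palette_size_def using e \<open>1 * 1 \<le> ?g\<close> d
    by (simp add: of_nat_nat algebra_simps) linarith
  moreover have "(1 + slack n d) * real d = real d + 16 * ?g"
    using e by (simp add: algebra_simps)
  ultimately show ?thesis by (simp add: color_bound_def)
qed

text \<open>The exponent 5/6 reflects the sixth power in the failure bound: a slack of order (ln n /
  \<Delta>)^(1/6) costs \<Delta>^(5/6) * (ln n)^(1/6) extra colors.\<close>

theorem theorem1p1:
  "\<exists>\<gamma>::real. 0 < \<gamma> \<and> \<gamma> < 1 \<and>
    (\<exists>A::online_algorithm. online_edge_coloring_algorithm A \<and>
      (\<exists>C::real. \<exists>c::real. C > 0 \<and> c > 0 \<and>
        (\<forall>\<Delta>::nat \<Rightarrow> nat. (\<lambda>n. real (\<Delta> n)) \<in> \<omega>(\<lambda>n. ln (real n)) \<longrightarrow>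
          (\<forall>\<^sub>F n in sequentially. \<forall>V E.
             simple_graph V E \<and> card V = n \<and> max_degree V E = \<Delta> n \<longrightarrow>
             measure_pmf.prob (random_order_run A V E)
               {col. proper_edge_coloring E col \<and> real (card (col ` E)) \<le> color_bound C \<gamma> n (\<Delta> n)}
             \<ge> 1 - 1 / real n powr c) \<and>
          asymp_equiv (\<lambda>n. color_bound C \<gamma> n (\<Delta> n)) sequentially (\<lambda>n. real (\<Delta> n)))))"
proof (rule exI[of _ "5/6"], intro conjI, simp, simp, rule exI[of _ palette_algorithm], rule conjI,
    rule palette_algorithm_proper, rule exI[of _ 32], rule exI[of _ 1], intro conjI allI impI)
  fix \<Delta> :: "nat \<Rightarrow> nat"
  assume omega: "(\<lambda>n. real (\<Delta> n)) \<in> \<omega>(\<lambda>n. ln (real n))"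
  let ?r = "\<lambda>n. ln (real n) / real (\<Delta> n)"
  have r: "eventually (\<lambda>n. K * ln (real n) \<le> real (\<Delta> n)) sequentially" if "0 < K" for K
    using landau_omega.smallD[OF omega that] eventually_ge_at_top[of 1]
    by eventually_elim simp
  have ln1: "eventually (\<lambda>n. 1 \<le> ln (real n)) sequentially"
    using eventually_ge_at_top[of 3]
  proof eventually_elim
    case (elim n)
    then have "exp 1 \<le> real n" using exp_le by linarith
    with elim show ?case by (simp add: ln_ge_iff)
  qed
  have r1: "eventually (\<lambda>n. ln (real n) \<le> real (\<Delta> n)) sequentially" using r[of 1] by simp
  \<comment> \<open>Since 2^30 = 32^6, this makes the slack at most 16 / 32.\<close>
  have r30: "eventually (\<lambda>n. 2 ^ 30 * ln (real n) \<le> real (\<Delta> n)) sequentially" by (rule r) simp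
  show "\<forall>\<^sub>F n in sequentially. \<forall>V E.
             simple_graph V E \<and> card V = n \<and> max_degree V E = \<Delta> n \<longrightarrow>
             measure_pmf.prob (random_order_run palette_algorithm V E)
               {col. proper_edge_coloring E col \<and> real (card (col ` E)) \<le> color_bound 32 (5/6) n (\<Delta> n)}
             \<ge> 1 - 1 / real n powr 1"
    using r30 r1 ln1 eventually_ge_at_top[of 2]
  proof eventually_elim
    case (elim n)
    show ?case
    proof (intro allI impI, elim conjE)
      fix V E assume G: "simple_graph V E" "card V = n" "max_degree V E = \<Delta> n"
      have d: "0 < \<Delta> n" using elim by linarith
      have "slack n (\<Delta> n) \<le> 16 * ((1/32) ^ 6) powr (1/6)"
        unfolding slack_def using elim d
        by (intro mult_left_mono powr_mono2) (auto simp: pos_divide_le_eq power_divide)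
      also have "((1/32::real) ^ 6) powr (1/6) = 1/32"
        by (simp only: powr_realpow[symmetric] powr_powr) simp
      finally have "slack n (\<Delta> n) \<le> 1/2" by simp
      from palette_algorithm_prob[OF G \<open>2 \<le> n\<close> \<open>1 \<le> ln (real n)\<close> d this]
      have "1 - 1 / real n \<le> measure_pmf.prob (random_order_run palette_algorithm V E)
          {col. proper_edge_coloring E col \<and> card (col ` E) \<le> palette_size n (\<Delta> n)}" .
      also have "\<dots> \<le> measure_pmf.prob (random_order_run palette_algorithm V E)
          {col. proper_edge_coloring E col \<and> real (card (col ` E)) \<le> color_bound 32 (5/6) n (\<Delta> n)}"
        using palette_size_le_color_bound[of n "\<Delta> n"] elim
        by (intro measure_pmf.finite_measure_mono) auto
      finally show "1 - 1 / real n powr 1 \<le> measure_pmf.prob (random_order_run palette_algorithm V E)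
          {col. proper_edge_coloring E col \<and> real (card (col ` E)) \<le> color_bound 32 (5/6) n (\<Delta> n)}"
        using elim by simp
    qed
  qed
  show "asymp_equiv (\<lambda>n. color_bound 32 (5/6) n (\<Delta> n)) sequentially (\<lambda>n. real (\<Delta> n))"
  proof (rule asymp_equivI')
    have "((\<lambda>n. ?r n) \<longlongrightarrow> 0) sequentially"
      using smalloD_tendsto[of "\<lambda>n. ln (real n)" sequentially "\<lambda>n. real (\<Delta> n)"] omega
      by (simp add: smallomega_iff_smallo)
    moreover have "eventually (\<lambda>n. 0 \<le> ?r n) sequentially"
      using ln1 by eventually_elim simp
    ultimately have "((\<lambda>n. ?r n powr (1/6)) \<longlongrightarrow> 0 powr (1/6)) sequentially"
      by (intro tendsto_powr2 tendsto_const) auto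
    from tendsto_add[OF tendsto_const[of 1] tendsto_mult[OF tendsto_const[of 32] this]]
    have lim: "((\<lambda>n. 1 + 32 * ?r n powr (1/6)) \<longlongrightarrow> 1) sequentially" by simp
    \<comment> \<open>The relative excess is 32 times the sixth root of ln n / \<Delta>, which tends
      to 0 by the growth assumption.\<close>
    have "eventually (\<lambda>n. 1 + 32 * ?r n powr (1/6) = color_bound 32 (5/6) n (\<Delta> n) / real (\<Delta> n)) sequentially"
      using r1 ln1
    proof eventually_elim
      case (elim n)
      then have d: "0 < real (\<Delta> n)" by linarith
      have "?r n powr (1/6) = ln (real n) powr (1/6) / real (\<Delta> n) powr (1/6)"
        using elim by (simp add: powr_divide)
      also have "1 / real (\<Delta> n) powr (1/6) = real (\<Delta> n) powr (5/6) / real (\<Delta> n)"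
        using d powr_diff[of "real (\<Delta> n)" "5/6" 1] powr_minus_divide[of "real (\<Delta> n)" "1/6"] by simp
      then have "ln (real n) powr (1/6) / real (\<Delta> n) powr (1/6)
          = real (\<Delta> n) powr (5/6) * ln (real n) powr (1/6) / real (\<Delta> n)"
        by (metis mult.commute times_divide_eq_right mult_1_right)
      finally show ?case using d by (simp add: color_bound_def add_divide_distrib)
    qed
    from Lim_transform_eventually[OF lim this]
    show "((\<lambda>n. color_bound 32 (5/6) n (\<Delta> n) / real (\<Delta> n)) \<longlongrightarrow> 1) sequentially" .
  qed
qed simp_all

end
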